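(* Let $Z=\{Z_t,\ t\ge 0\}$ be a real strictly stable process with index $\alpha\in(0,1)$, with Lévy measure $\nu(dz)=c_+z^{-\alpha-1}\mathbf 1_{\{z>0\}}dz+c_-|z|^{-\alpha-1}\mathbf 1_{\{z<0\}}dz$, where $c_+,c_-\ge 0$ and $c_++c_->0$. Then for every $p\in(\alpha,1]$, $$\lim_{\varepsilon\downarrow 0}\varepsilon^{\frac{p\alpha}{p-\alpha}}\log\mathbb P\left[\|Z\|_p\le\varepsilon\right]=-\left(\frac{p-\alpha}{\alpha}\right)\left(\frac{c_-+c_+}{p}\,\Gamma(1-\alpha/p)\right)^{\frac{p}{p-\alpha}}.$$ Besides, if $|Z|$ is a subordinator, then for every $p>1$, $$\lim_{\varepsilon\downarrow 0}\varepsilon^{\frac{\alpha}{1-\alpha}}\log\mathbb P\left[\|Z\|_p\le\varepsilon\right]=-\left(\frac1\alpha-1\right)\left(c_{\pm}\,\Gamma(1-\alpha)\right)^{\frac{1}{1-\alpha}},$$ where $c_\pm=c_+$ if $Z$ is a subordinator and $c_\pm=c_-$ if $-Z$ is a subordinator.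
   Context: A real strictly stable process with index $\alpha\in(0,2]$ is a real Lévy process $Z$ (with $Z_0=0$) such that for every $k>0$, $\{Z_{kt},\,t\ge0\}$ and $\{k^{1/\alpha}Z_t,\,t\ge0\}$ have the same law; the trivial case where $Z$ is a pure drift (including $Z\equiv0$) is excluded, and a càdlàg version is used. When $\alpha<1$, strict stability implies that $Z$ is the sum of its jumps, $Z_t=\sum_{s\le t}\Delta Z_s$. The strong $p$-variation ($p>0$) on $[0,1]$ of a function $f$ is $$\|f\|_p=\left(\sup_{t_0<\dots<t_k\in[0,1]}\sum_{j=1}^k|f(t_j)-f(t_{j-1})|^p\right)^{1/p},$$ the supremum being over all $k$ and all such finite sequences. "$|Z|$ is a subordinator" means that $Z$ or $-Z$ is a subordinator (a Lévy process with a.s. nondecreasing paths). $\Gamma$ is the Gamma function. *)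

theory Defs
  imports "HOL-Probability.Probability"
begin

section \<open>Levy processes\<close>

text \<open>Processes are indexed by \<open>real\<close>; only the values at times \<open>t \<ge> 0\<close> matter.\<close>

definition cadlag :: "(real \<Rightarrow> real) \<Rightarrow> bool" where
  "cadlag f \<longleftrightarrow>
     (\<forall>t\<ge>0. (f \<longlongrightarrow> f t) (at_right t)) \<and> (\<forall>t>0. \<exists>l. (f \<longlongrightarrow> l) (at_left t))"

text \<open>All paths, not just almost all, are cadlag, so that path functionals given by suprema over
  uncountably many times are measurable without completing the probability space.\<close>

definition levy_process :: "'a measure \<Rightarrow> (real \<Rightarrow> 'a \<Rightarrow> real) \<Rightarrow> bool" where
  "levy_process M Z \<longleftrightarrow>
     prob_space M \<and>
     (\<forall>t\<ge>0. Z t \<in> borel_measurable M) \<and>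
     (AE \<omega> in M. Z 0 \<omega> = 0) \<and>
     (\<forall>(n::nat) (t::nat \<Rightarrow> real). 0 \<le> t 0 \<longrightarrow> (\<forall>i<n. t i \<le> t (Suc i)) \<longrightarrow>
        prob_space.indep_vars M (\<lambda>_. borel) (\<lambda>i \<omega>. Z (t (Suc i)) \<omega> - Z (t i) \<omega>) {..<n}) \<and>
     (\<forall>s\<ge>0. \<forall>h\<ge>0. distr M borel (\<lambda>\<omega>. Z (s + h) \<omega> - Z s \<omega>) = distr M borel (Z h)) \<and>
     (\<forall>\<omega>\<in>space M. cadlag (\<lambda>t. Z t \<omega>))"

definition subordinator :: "'a measure \<Rightarrow> (real \<Rightarrow> 'a \<Rightarrow> real) \<Rightarrow> bool" where
  "subordinator M Z \<longleftrightarrow>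
     levy_process M Z \<and> (AE \<omega> in M. \<forall>s t. 0 \<le> s \<longrightarrow> s \<le> t \<longrightarrow> Z s \<omega> \<le> Z t \<omega>)"

definition process_law :: "'a measure \<Rightarrow> (real \<Rightarrow> 'a \<Rightarrow> real) \<Rightarrow> (real \<Rightarrow> real) measure" where
  "process_law M Z = distr M (\<Pi>\<^sub>M t\<in>{0..}. borel) (\<lambda>\<omega>. \<lambda>t\<in>{0..}. Z t \<omega>)"

definition strictly_stable_process ::
    "'a measure \<Rightarrow> real \<Rightarrow> (real \<Rightarrow> 'a \<Rightarrow> real) \<Rightarrow> bool" where
  "strictly_stable_process M \<alpha> Z \<longleftrightarrow>
     \<alpha> \<in> {0<..2} \<and> levy_process M Z \<and>
     (\<forall>k>0. process_law M (\<lambda>t. Z (k * t)) = process_law M (\<lambda>t \<omega>. k powr (1 / \<alpha>) * Z t \<omega>)) \<and>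
     \<not> (\<exists>b. AE \<omega> in M. \<forall>t\<ge>0. Z t \<omega> = b * t)"


section \<open>Levy measures\<close>

definition levy_khintchine_exponent :: "real \<Rightarrow> real \<Rightarrow> real measure \<Rightarrow> real \<Rightarrow> complex" where
  "levy_khintchine_exponent b v \<nu> u =
     \<i> * complex_of_real (b * u) - complex_of_real (v * u\<^sup>2 / 2) +
     (\<integral>z. iexp (u * z) - 1 - \<i> * complex_of_real (u * z * indicator {-1..1} z) \<partial>\<nu>)"

text \<open>\<open>\<nu>\<close> is the third component of the Levy--Khintchine triplet (drift \<open>b\<close>, Gaussian variance
  \<open>v\<close>, \<open>\<nu>\<close>) of \<open>Z\<close>, which is unique.\<close>

definition has_levy_measure ::
    "'a measure \<Rightarrow> (real \<Rightarrow> 'a \<Rightarrow> real) \<Rightarrow> real measure \<Rightarrow> bool" where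
  "has_levy_measure M Z \<nu> \<longleftrightarrow>
     sets \<nu> = sets borel \<and> emeasure \<nu> {0} = 0 \<and>
     (\<integral>\<^sup>+z. ennreal (min 1 (z\<^sup>2)) \<partial>\<nu>) < \<infinity> \<and>
     (\<exists>b v. 0 \<le> v \<and>
        (\<forall>t\<ge>0. \<forall>u. char (distr M borel (Z t)) u =
           exp (complex_of_real t * levy_khintchine_exponent b v \<nu> u)))"

definition stable_levy_measure :: "real \<Rightarrow> real \<Rightarrow> real \<Rightarrow> real measure" where
  "stable_levy_measure \<alpha> c\<^sub>p c\<^sub>m = density lborel (\<lambda>z. ennreal
     (c\<^sub>p * z powr (-\<alpha> - 1) * indicator {0<..} z + c\<^sub>m * \<bar>z\<bar> powr (-\<alpha> - 1) * indicator {..<0} z))"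


section \<open>Strong variation\<close>

text \<open>The supremum may be infinite, hence the values in \<open>ennreal\<close>; \<open>powr\<close> is not available
  there, so the \<open>p\<close>-th root is taken by cases.\<close>

definition pvar_sup :: "real \<Rightarrow> (real \<Rightarrow> real) \<Rightarrow> ennreal" where
  "pvar_sup p f =
     (SUP (k, t) \<in> {(k::nat, t::nat \<Rightarrow> real). (\<forall>j\<le>k. t j \<in> {0..1}) \<and> (\<forall>j<k. t j < t (Suc j))}.
        ennreal (\<Sum>j=1..k. \<bar>f (t j) - f (t (j - 1))\<bar> powr p))"

definition strong_pvar :: "real \<Rightarrow> (real \<Rightarrow> real) \<Rightarrow> ennreal" where
  "strong_pvar p f =
     (if pvar_sup p f = \<infinity> then \<infinity> else ennreal (enn2real (pvar_sup p f) powr (1 / p)))"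

end

theory Submission
  imports Defs
begin

text \<open>For \<open>p \<le> 1\<close> the map \<open>x \<mapsto> \<bar>x\<bar> powr p\<close> is subadditive, so for a cadlag path the supremum
  \<open>S\<close> defining the variation is the increasing limit of the sums over dyadic partitions. By
  independence and stationarity of the increments, \<open>E exp (- l S)\<close> is the limit of
  \<open>(E exp (- l \<bar>Z t\<bar> powr p)) ^ (1 / t)\<close> along \<open>t = 1 / 2 ^ n\<close>, hence
  \<open>exp (- \<integral>z. 1 - exp (- l \<bar>z\<bar> powr p) \<partial>\<nu>)\<close> provided that
  \<open>E (1 - exp (- l \<bar>Z t\<bar> powr p)) / t\<close> tends to this \<open>\<nu>\<close>-integral. Only characteristic functions
  are needed for the latter: \<open>1 - exp (- l \<bar>z\<bar> powr p)\<close> is, by concavity, a mixture of the functions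
  \<open>min \<bar>z\<bar> s\<close>, and these are mixtures of \<open>1 - cos (x z)\<close>. So \<open>S\<close> has the Laplace transform of a
  positive stable variable of index \<open>\<alpha> / p\<close>, and De Bruijn's Tauberian theorem (Chernoff bound
  and exponential tilting) yields the small deviations. Strict stability enters only through the
  vanishing of the drift and of the Gaussian part. For monotone paths and \<open>p \<ge> 1\<close> the variation
  equals \<open>\<bar>Z 1 - Z 0\<bar>\<close>, which reduces the case \<open>p > 1\<close> to \<open>p = 1\<close>.\<close>

text \<open>Divided by t, the law of \<open>Z t\<close> can approach \<nu> only away from 0, where
  \<nu> has infinite mass, and only its characteristic function is known. Test functions are
  therefore chosen on the Fourier side: against the kernel (1 - cos (s x)) / x^2, the quotient (1 -
  exp (- t \<Psi> x)) / t is dominated, uniformly in t, by a multiple of |x|^\<alpha>, which is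
  integrable precisely because \<alpha> < 1. The kernel corresponds to the functions min |z - y| s -
  min |y| s, which vanish at z = 0. The shift y = 0 serves the Laplace transform. A nonzero y
  settles a point that the limit for p = 1 leaves open: its constant contains the sum of both
  coefficients, so for monotone paths the coefficient of the other sign must be shown to vanish, and
  a bump away from 0 detects jumps of that sign. Finiteness of the variation is not known
  beforehand. Paths of infinite variation contribute 0 to the Laplace transform, and the Tauberian
  theorem is applied to the probability restricted to the remaining paths.\<close>

section \<open>De Bruijn's Tauberian theorem\<close>

text \<open>Outside the window a < R \<le> b the integrand exp (- l R) is dominated at shifted
  parameters: exp (\<theta> (a - R)) is at least 1 for R \<le> a, and exp (\<theta> (R - b)) is at
  least 1 for R > b. Inside the window exp (- l R) is below exp (- l a), and the mass of the window
  is at most that of R \<le> b.\<close>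

lemma tauberian_split:
  fixes \<kappa> \<beta> :: real
  assumes N: "finite_measure N" and R[measurable]: "R \<in> borel_measurable N"
    and nn: "\<And>x. x \<in> space N \<Longrightarrow> 0 \<le> R x"
    and lt: "\<And>l. 0 < l \<Longrightarrow> (\<integral>x. exp (- (l * R x)) \<partial>N) = exp (- (\<kappa> * l powr \<beta>))"
    and l: "0 < \<theta>" "\<theta> < l"
  shows "exp (- (\<kappa> * l powr \<beta>)) \<le> exp (- (l * a)) * measure N {x \<in> space N. R x \<le> b}
           + exp (\<theta> * a - \<kappa> * (l + \<theta>) powr \<beta>) + exp (- (\<theta> * b) - \<kappa> * (l - \<theta>) powr \<beta>)"
proof -
  interpret finite_measure N by fact
  have int[simp]: "integrable N (\<lambda>x. exp (- (k * R x)))" if "0 < k" for k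
    by (rule integrable_const_bound[of _ 1]) (use nn that in \<open>auto intro!: AE_I2 mult_nonneg_nonneg\<close>)
  have "exp (- (\<kappa> * l powr \<beta>)) = (\<integral>x. exp (- (l * R x)) \<partial>N)"
    using lt l by simp
  also have "\<dots> \<le> (\<integral>x. exp (- (l * a)) * indicator {x \<in> space N. R x \<le> b} x
      + exp (\<theta> * a) * exp (- ((l + \<theta>) * R x)) + exp (- (\<theta> * b)) * exp (- ((l - \<theta>) * R x)) \<partial>N)"
  proof (rule integral_mono)
    show "integrable N (\<lambda>x. exp (- (l * a)) * indicator {x \<in> space N. R x \<le> b} x
      + exp (\<theta> * a) * exp (- ((l + \<theta>) * R x)) + exp (- (\<theta> * b)) * exp (- ((l - \<theta>) * R x)))"
      using l by (intro Bochner_Integration.integrable_add integrable_mult_right int) (auto simp: integrable_indicator_iff less_top[symmetric])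
    fix x assume x: "x \<in> space N"
    have 1: "exp (\<theta> * a) * exp (- ((l + \<theta>) * R x)) = exp (\<theta> * (a - R x)) * exp (- (l * R x))"
      "exp (- (\<theta> * b)) * exp (- ((l - \<theta>) * R x)) = exp (\<theta> * (R x - b)) * exp (- (l * R x))"
      by (simp_all add: exp_add[symmetric] algebra_simps)
    consider "R x \<le> a" | "b < R x" | "a < R x" "R x \<le> b" by linarith
    then show "exp (- (l * R x)) \<le> exp (- (l * a)) * indicator {x \<in> space N. R x \<le> b} x
      + exp (\<theta> * a) * exp (- ((l + \<theta>) * R x)) + exp (- (\<theta> * b)) * exp (- ((l - \<theta>) * R x))"
    proof cases
      case 1
      then have "1 \<le> exp (\<theta> * (a - R x))" using l by simp
      then have "exp (- (l * R x)) \<le> exp (\<theta> * (a - R x)) * exp (- (l * R x))" by simp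
      then show ?thesis unfolding \<open>exp (\<theta> * a) * _ = _\<close>
        by (intro order_trans[OF _ add_increasing2] add_increasing) auto
    next
      case 2
      then have "1 \<le> exp (\<theta> * (R x - b))" using l by simp
      then have "exp (- (l * R x)) \<le> exp (\<theta> * (R x - b)) * exp (- (l * R x))" by simp
      then show ?thesis unfolding \<open>exp (- (\<theta> * b)) * _ = _\<close>
        by (intro add_increasing) auto
    next
      case 3
      then have "exp (- (l * R x)) \<le> exp (- (l * a))" using l by simp
      then show ?thesis using 3 x
        by (intro order_trans[OF _ add_increasing2] add_increasing2) auto
    qed
  qed (use l in auto)
  also have "\<dots> = exp (- (l * a)) * measure N {x \<in> space N. R x \<le> b}
      + exp (\<theta> * a) * exp (- (\<kappa> * (l + \<theta>) powr \<beta>)) + exp (- (\<theta> * b)) * exp (- (\<kappa> * (l - \<theta>) powr \<beta>))"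
    using l lt by (simp add: Bochner_Integration.integral_add less_top[symmetric])
  finally show ?thesis by (simp add: exp_add[symmetric])
qed

text \<open>Both margins come from the slope \<beta> of (1 + \<eta>)^\<beta> at 0, which lies
  strictly between \<beta> (1 - \<gamma>) and \<beta> (1 + \<gamma>): each difference starts at 1
  with derivative \<beta> \<gamma> > 0. The gap \<open>g\<close> makes the two error terms of
  \<open>tauberian_split\<close> exponentially smaller than the transform itself.\<close>

lemma tilting_gap:
  fixes \<beta> \<gamma> :: real
  assumes "0 < \<beta>" "0 < \<gamma>"
  obtains \<eta> g where "0 < \<eta>" "\<eta> < 1" "0 < g" "1 + g + \<eta> * \<beta> * (1 - \<gamma>) \<le> (1 + \<eta>) powr \<beta>"
    "1 + g - \<eta> * \<beta> * (1 + \<gamma>) \<le> (1 - \<eta>) powr \<beta>"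
proof -
  have "((\<lambda>\<eta>. (1 + \<eta>) powr \<beta> - \<eta> * \<beta> * (1 - \<gamma>)) has_real_derivative \<beta> * \<gamma>) (at 0)"
    by (rule derivative_eq_intros refl | simp add: algebra_simps)+
  then obtain d1 where d1: "d1 > 0" "\<And>h. 0 < h \<Longrightarrow> h < d1 \<Longrightarrow> 1 < (1 + h) powr \<beta> - h * \<beta> * (1 - \<gamma>)"
    using DERIV_pos_inc_right[of "\<lambda>\<eta>. (1 + \<eta>) powr \<beta> - \<eta> * \<beta> * (1 - \<gamma>)" "\<beta> * \<gamma>" 0] assms by auto
  have "((\<lambda>\<eta>. (1 - \<eta>) powr \<beta> + \<eta> * \<beta> * (1 + \<gamma>)) has_real_derivative \<beta> * \<gamma>) (at 0)"
    by (rule derivative_eq_intros refl | simp add: algebra_simps)+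
  then obtain d2 where d2: "d2 > 0" "\<And>h. 0 < h \<Longrightarrow> h < d2 \<Longrightarrow> 1 < (1 - h) powr \<beta> + h * \<beta> * (1 + \<gamma>)"
    using DERIV_pos_inc_right[of "\<lambda>\<eta>. (1 - \<eta>) powr \<beta> + \<eta> * \<beta> * (1 + \<gamma>)" "\<beta> * \<gamma>" 0] assms by auto
  define \<eta> where "\<eta> = min (min d1 d2) 1 / 2"
  have \<eta>: "0 < \<eta>" "\<eta> < 1" "\<eta> < d1" "\<eta> < d2" using d1 d2 by (auto simp: \<eta>_def min_def)
  define g where "g = min ((1 + \<eta>) powr \<beta> - \<eta> * \<beta> * (1 - \<gamma>) - 1) ((1 - \<eta>) powr \<beta> + \<eta> * \<beta> * (1 + \<gamma>) - 1)"
  show ?thesis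
    by (rule that[of \<eta> g]) (use \<eta> d1(2)[of \<eta>] d2(2)[of \<eta>] in \<open>auto simp: g_def\<close>)
qed

text \<open>Under the tilted weight exp (- L R) the variable R concentrates at \<kappa> \<beta>
  L^(\<beta> - 1), the derivative of \<kappa> L^\<beta>. The window reaches from (1 - \<gamma>) to
  (1 + \<gamma>) times this value, with \<open>d\<close> as its right end. Positivity is part of the
  conclusion since, with \<open>ln 0 = 0\<close>, the inequality alone does not exclude a null
  event.\<close>

lemma de_bruijn_lower:
  fixes \<kappa> \<beta> \<gamma> :: real
  assumes N: "finite_measure N" and R[measurable]: "R \<in> borel_measurable N"
    and nn: "\<And>x. x \<in> space N \<Longrightarrow> 0 \<le> R x"
    and \<beta>: "0 < \<beta>" "\<beta> < 1" and \<kappa>: "0 < \<kappa>"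
    and lt: "\<And>l. 0 < l \<Longrightarrow> (\<integral>x. exp (- (l * R x)) \<partial>N) = exp (- (\<kappa> * l powr \<beta>))"
    and \<gamma>: "0 < \<gamma>"
  shows "\<forall>\<^sub>F d in at_right 0. 0 < measure N {x \<in> space N. R x \<le> d} \<and>
     \<kappa> * ((1 + \<gamma>) * (\<kappa> * \<beta>)) powr (\<beta> / (1 - \<beta>)) * ((1 - \<gamma>) * \<beta> - 1) - d powr (\<beta> / (1 - \<beta>)) * ln 2
       \<le> d powr (\<beta> / (1 - \<beta>)) * ln (measure N {x \<in> space N. R x \<le> d})"
proof -
  obtain \<eta> g where \<eta>: "0 < \<eta>" "\<eta> < 1" "0 < g" "1 + g + \<eta> * \<beta> * (1 - \<gamma>) \<le> (1 + \<eta>) powr \<beta>"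
    "1 + g - \<eta> * \<beta> * (1 + \<gamma>) \<le> (1 - \<eta>) powr \<beta>"
    using tilting_gap[OF \<beta>(1) \<gamma>] by blast
  define c where "c = \<kappa> * \<beta>"
  have c: "0 < c" using \<beta> \<kappa> by (simp add: c_def)
  \<comment> \<open>Solves (1 + \<gamma>) \<kappa> \<beta> L^(\<beta> - 1) = d, which places
    \<open>d\<close> at the right end of the window.\<close>
  define L where "L d = ((1 + \<gamma>) * c / d) powr (1 / (1 - \<beta>))" for d
  have lim: "filterlim (\<lambda>d. \<kappa> * g * L d powr \<beta>) at_top (at_right 0)"
  proof -
    have "filterlim (\<lambda>d::real. (1 + \<gamma>) * c / d) at_top (at_right 0)"
      using \<gamma> c by real_asymp
    moreover have "filterlim (\<lambda>x. \<kappa> * g * ((x powr (1 / (1 - \<beta>))) powr \<beta>)) at_top at_top"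
      using \<kappa> \<eta> \<beta> by (simp add: powr_powr) (real_asymp)
    ultimately show ?thesis unfolding L_def by (rule filterlim_compose[rotated])
  qed
  have "\<forall>\<^sub>F d in at_right 0. ln 4 \<le> \<kappa> * g * L d powr \<beta>"
    using lim by (auto simp: filterlim_at_top)
  then show ?thesis using eventually_at_right_less[of 0]
  proof eventually_elim
    fix d :: real
    \<comment> \<open>The threshold ln 4 brings each of the two error terms below a quarter of the
      transform, so that half of it is left for the window; this half is the ln 2 of the
      conclusion.\<close>
    assume big: "ln 4 \<le> \<kappa> * g * L d powr \<beta>" and d: "0 < d"
    let ?L = "L d" and ?P = "measure N {x \<in> space N. R x \<le> d}"
    have L: "0 < ?L" using d c \<gamma> by (simp add: L_def)
    have "?L powr (1 - \<beta>) = (1 + \<gamma>) * c / d" using \<beta> d c \<gamma> by (simp add: L_def powr_powr)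
    then have b: "d = (1 + \<gamma>) * c / ?L powr (1 - \<beta>)" using d L by (simp add: field_simps)
    have LL: "?L = ?L powr \<beta> * ?L powr (1 - \<beta>)" using L by (simp add: powr_add[symmetric])
    have Ld: "?L * d = (1 + \<gamma>) * c * ?L powr \<beta>"
      using LL L by (subst b, subst LL) (simp add: field_simps)
    define a where "a = (1 - \<gamma>) * c / ?L powr (1 - \<beta>)"
    have La: "?L * a = (1 - \<gamma>) * c * ?L powr \<beta>"
      unfolding a_def using LL L by (subst LL) (simp add: field_simps)
    have plus: "(?L + \<eta> * ?L) powr \<beta> = ?L powr \<beta> * (1 + \<eta>) powr \<beta>"
      using L \<eta> by (subst powr_mult[symmetric]) (auto simp: algebra_simps)
    have minus: "(?L - \<eta> * ?L) powr \<beta> = ?L powr \<beta> * (1 - \<eta>) powr \<beta>"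
      using L \<eta> by (subst powr_mult[symmetric]) (auto simp: algebra_simps)
    have kL: "0 \<le> \<kappa> * ?L powr \<beta>" using \<kappa> by simp
    have e1: "\<eta> * ?L * a - \<kappa> * (?L + \<eta> * ?L) powr \<beta> \<le> - (\<kappa> * ?L powr \<beta>) - ln 4"
    proof -
      have "\<eta> * ?L * a - \<kappa> * (?L + \<eta> * ?L) powr \<beta> = (\<kappa> * ?L powr \<beta>) * (\<eta> * \<beta> * (1 - \<gamma>) - (1 + \<eta>) powr \<beta>)"
        using La by (simp add: plus mult.assoc) (simp add: c_def algebra_simps)
      also have "\<dots> \<le> (\<kappa> * ?L powr \<beta>) * (- 1 - g)" using \<eta>(4) kL by (intro mult_left_mono) linarith+
      also have "\<dots> \<le> - (\<kappa> * ?L powr \<beta>) - ln 4" using big by (simp add: algebra_simps)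
      finally show ?thesis .
    qed
    have e2: "- (\<eta> * ?L * d) - \<kappa> * (?L - \<eta> * ?L) powr \<beta> \<le> - (\<kappa> * ?L powr \<beta>) - ln 4"
    proof -
      have "- (\<eta> * ?L * d) - \<kappa> * (?L - \<eta> * ?L) powr \<beta> = (\<kappa> * ?L powr \<beta>) * (- (\<eta> * \<beta> * (1 + \<gamma>)) - (1 - \<eta>) powr \<beta>)"
        using Ld by (simp add: minus mult.assoc) (simp add: c_def algebra_simps)
      also have "\<dots> \<le> (\<kappa> * ?L powr \<beta>) * (- 1 - g)" using \<eta>(5) kL by (intro mult_left_mono) linarith+
      also have "\<dots> \<le> - (\<kappa> * ?L powr \<beta>) - ln 4" using big by (simp add: algebra_simps)
      finally show ?thesis .
    qed
    let ?E = "exp (- (\<kappa> * ?L powr \<beta>))"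
    have q: "exp (- (\<kappa> * ?L powr \<beta>) - ln 4) = ?E / 4" by (simp add: exp_diff)
    have "?E \<le> exp (- (?L * a)) * ?P + exp (\<eta> * ?L * a - \<kappa> * (?L + \<eta> * ?L) powr \<beta>) +
        exp (- (\<eta> * ?L * d) - \<kappa> * (?L - \<eta> * ?L) powr \<beta>)"
      by (rule tauberian_split[OF N R nn lt]) (use L \<eta> in auto)
    moreover have "exp (\<eta> * ?L * a - \<kappa> * (?L + \<eta> * ?L) powr \<beta>) \<le> ?E / 4"
      using e1 unfolding q[symmetric] by simp
    moreover have "exp (- (\<eta> * ?L * d) - \<kappa> * (?L - \<eta> * ?L) powr \<beta>) \<le> ?E / 4"
      using e2 unfolding q[symmetric] by simp
    ultimately have *: "?E / 2 \<le> exp (- (?L * a)) * ?P" by linarith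
    then have "0 < exp (- (?L * a)) * ?P" by (rule less_le_trans[rotated]) simp
    then have pos: "0 < ?P" by (simp add: zero_less_mult_iff)
    have "- (\<kappa> * ?L powr \<beta>) - ln 2 = ln (?E / 2)" by (simp add: ln_div)
    also have "\<dots> \<le> ln (exp (- (?L * a)) * ?P)" using * by (subst ln_le_cancel_iff) (use pos in auto)
    also have "\<dots> = - (?L * a) + ln ?P" using pos by (simp add: ln_mult)
    finally have "- (\<kappa> * ?L powr \<beta>) - ln 2 \<le> - ((1 - \<gamma>) * c * ?L powr \<beta>) + ln ?P"
      by (simp only: La)
    then have "(\<kappa> * ?L powr \<beta>) * ((1 - \<gamma>) * \<beta> - 1) - ln 2 \<le> ln ?P"
      by (simp add: c_def algebra_simps)
    then have "d powr (\<beta> / (1 - \<beta>)) * ((\<kappa> * ?L powr \<beta>) * ((1 - \<gamma>) * \<beta> - 1) - ln 2) \<le> d powr (\<beta> / (1 - \<beta>)) * ln ?P"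
      by (intro mult_left_mono) auto
    moreover have dL: "d powr (\<beta> / (1 - \<beta>)) * ?L powr \<beta> = ((1 + \<gamma>) * c) powr (\<beta> / (1 - \<beta>))"
      using d c \<gamma> by (simp add: L_def powr_powr powr_divide)
    have "d powr (\<beta> / (1 - \<beta>)) * ((\<kappa> * ?L powr \<beta>) * ((1 - \<gamma>) * \<beta> - 1) - ln 2)
       = \<kappa> * ((1 + \<gamma>) * c) powr (\<beta> / (1 - \<beta>)) * ((1 - \<gamma>) * \<beta> - 1) - d powr (\<beta> / (1 - \<beta>)) * ln 2"
      unfolding dL[symmetric] by (simp add: algebra_simps)
    ultimately show "0 < ?P \<and> \<kappa> * ((1 + \<gamma>) * (\<kappa> * \<beta>)) powr (\<beta> / (1 - \<beta>)) * ((1 - \<gamma>) * \<beta> - 1) - d powr (\<beta> / (1 - \<beta>)) * ln 2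
       \<le> d powr (\<beta> / (1 - \<beta>)) * ln ?P"
      using pos by (simp add: c_def)
  qed
qed

text \<open>Chernoff bound: exp (L (d - R)) is at least 1 on R \<le> d, taken at the minimiser L =
  (\<kappa> \<beta> / d)^(1 / (1 - \<beta>)) of L d - \<kappa> L^\<beta>. It holds for every d > 0,
  not only in the limit. The event must have positive measure because \<open>ln 0 = 0\<close> would
  exceed the negative bound.\<close>

lemma de_bruijn_upper:
  fixes \<kappa> \<beta> :: real
  assumes N: "finite_measure N" and R[measurable]: "R \<in> borel_measurable N"
    and nn: "\<And>x. x \<in> space N \<Longrightarrow> 0 \<le> R x"
    and \<beta>: "0 < \<beta>" "\<beta> < 1" and \<kappa>: "0 < \<kappa>"
    and lt: "\<And>l. 0 < l \<Longrightarrow> (\<integral>x. exp (- (l * R x)) \<partial>N) = exp (- (\<kappa> * l powr \<beta>))"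
    and d: "0 < d" and pos: "0 < measure N {x \<in> space N. R x \<le> d}"
  shows "d powr (\<beta> / (1 - \<beta>)) * ln (measure N {x \<in> space N. R x \<le> d})
    \<le> - ((1 - \<beta>) / \<beta>) * (\<kappa> * \<beta>) powr (1 / (1 - \<beta>))"
proof -
  interpret finite_measure N by fact
  let ?P = "measure N {x \<in> space N. R x \<le> d}"
  define c where "c = \<kappa> * \<beta>"
  have c: "0 < c" using \<beta> \<kappa> by (simp add: c_def)
  define L where "L = (c / d) powr (1 / (1 - \<beta>))"
  have L: "0 < L" using c d by (simp add: L_def)
  have "?P = (\<integral>x. indicator {x \<in> space N. R x \<le> d} x \<partial>N)" by simp
  also have "\<dots> \<le> (\<integral>x. exp (L * d) * exp (- (L * R x)) \<partial>N)"
  proof (rule integral_mono)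
    show "integrable N (\<lambda>x. exp (L * d) * exp (- (L * R x)))"
      by (intro integrable_mult_right integrable_const_bound[of _ 1])
        (use nn L in \<open>auto intro!: AE_I2 mult_nonneg_nonneg\<close>)
      show "integrable N (indicat_real {x \<in> space N. R x \<le> d})"
      by (auto simp: integrable_indicator_iff less_top[symmetric])
  qed (use L in \<open>auto simp: exp_add[symmetric] indicator_def\<close>)
  also have "\<dots> = exp (L * d - \<kappa> * L powr \<beta>)"
    by (subst integral_mult_right_zero) (use lt[OF L] in \<open>simp add: exp_diff exp_minus divide_inverse\<close>)
  finally have "ln ?P \<le> L * d - \<kappa> * L powr \<beta>"
    using pos by (metis exp_ln exp_le_cancel_iff)
  then have "d powr (\<beta> / (1 - \<beta>)) * ln ?P \<le> d powr (\<beta> / (1 - \<beta>)) * (L * d - \<kappa> * L powr \<beta>)"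
    by (intro mult_left_mono) auto
  also have "\<dots> = d powr (\<beta> / (1 - \<beta>)) * L * d - \<kappa> * (d powr (\<beta> / (1 - \<beta>)) * L powr \<beta>)"
    by (simp add: algebra_simps)
  also have "d powr (\<beta> / (1 - \<beta>)) * L powr \<beta> = c powr (\<beta> / (1 - \<beta>))"
    using d c by (simp add: L_def powr_powr powr_divide)
  also have "\<dots> = c powr (1 / (1 - \<beta>)) / c"
  proof -
    have "\<beta> / (1 - \<beta>) = 1 / (1 - \<beta>) - 1" using \<beta> by (simp add: field_simps)
    then show ?thesis using c by (simp add: powr_diff)
  qed
  also have "d powr (\<beta> / (1 - \<beta>)) * L * d = c powr (1 / (1 - \<beta>))"
  proof -
    have "d powr (\<beta> / (1 - \<beta>)) * d = d powr (\<beta> / (1 - \<beta>) + 1)" using d by (simp add: powr_add)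
    also have "\<beta> / (1 - \<beta>) + 1 = 1 / (1 - \<beta>)" using \<beta> by (simp add: field_simps)
    finally show ?thesis using d c by (simp add: L_def powr_divide) (simp add: field_simps)
  qed
  also have "c powr (1 / (1 - \<beta>)) - \<kappa> * (c powr (1 / (1 - \<beta>)) / c) = - ((1 - \<beta>) / \<beta>) * c powr (1 / (1 - \<beta>))"
    using \<beta> \<kappa> by (simp add: c_def field_simps)
  finally show ?thesis by (simp add: c_def)
qed

text \<open>The lower bound depends on \<gamma> through \<open>h\<close>, whose value at \<gamma> =
  0 is exactly the Chernoff constant. Allowing a finite measure \<open>N\<close> makes room for a
  probability restricted to an event; letting l tend to 0 in the transform shows that the mass of
  \<open>N\<close> is 1.\<close>

lemma de_bruijn_tauberian:
  fixes \<kappa> \<beta> :: real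
  assumes N: "finite_measure N" and R: "R \<in> borel_measurable N"
    and nn: "\<And>x. x \<in> space N \<Longrightarrow> 0 \<le> R x"
    and \<beta>: "0 < \<beta>" "\<beta> < 1" and \<kappa>: "0 < \<kappa>"
    and lt: "\<And>l. 0 < l \<Longrightarrow> (\<integral>x. exp (- (l * R x)) \<partial>N) = exp (- (\<kappa> * l powr \<beta>))"
  shows "((\<lambda>d. d powr (\<beta> / (1 - \<beta>)) * ln (measure N {x \<in> space N. R x \<le> d}))
    \<longlongrightarrow> - ((1 - \<beta>) / \<beta>) * (\<kappa> * \<beta>) powr (1 / (1 - \<beta>))) (at_right 0)"
    (is "(?f \<longlongrightarrow> ?l) _")
proof (rule order_tendstoI)
  define h where "h \<gamma> = \<kappa> * ((1 + \<gamma>) * (\<kappa> * \<beta>)) powr (\<beta> / (1 - \<beta>)) * ((1 - \<gamma>) * \<beta> - 1)" for \<gamma>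
  have lower: "\<forall>\<^sub>F d in at_right 0. 0 < measure N {x \<in> space N. R x \<le> d} \<and>
      h \<gamma> - d powr (\<beta> / (1 - \<beta>)) * ln 2 \<le> ?f d" if "0 < \<gamma>" for \<gamma>
    unfolding h_def by (rule de_bruijn_lower[OF N R nn \<beta> \<kappa> lt]) (use that in auto)
  have l: "?l = h 0"
  proof -
    have "1 / (1 - \<beta>) = \<beta> / (1 - \<beta>) + 1" using \<beta> by (simp add: field_simps)
    then have "(\<kappa> * \<beta>) powr (1 / (1 - \<beta>)) = (\<kappa> * \<beta>) powr (\<beta> / (1 - \<beta>)) * (\<kappa> * \<beta>)"
      using \<beta> \<kappa> by (metis powr_add powr_one mult_pos_pos less_imp_le)
    then show ?thesis using \<beta> by (simp add: h_def) (simp add: algebra_simps)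
  qed
  { fix u assume u: "?l < u"
    have "\<forall>\<^sub>F d in at_right 0. 0 < measure N {x \<in> space N. R x \<le> d}"
      \<comment> \<open>Any positive \<gamma> would do here, as only the positivity of the measure
        is taken from the lower bound.\<close>
      using lower[of 1] by (auto elim: eventually_mono)
    then show "\<forall>\<^sub>F d in at_right 0. ?f d < u" using eventually_at_right_less[of 0]
      by eventually_elim (use de_bruijn_upper[OF N R nn \<beta> \<kappa> lt] u in \<open>meson order.strict_trans1\<close>) }
  fix u assume u: "u < ?l"
  have "isCont h 0" unfolding h_def using \<beta> \<kappa> by (intro continuous_intros) auto
  then have "(h \<longlongrightarrow> h 0) (at_right 0)" by (auto simp: isCont_def intro: tendsto_mono at_le)
  then have "\<forall>\<^sub>F \<gamma> in at_right 0. u < h \<gamma>" using u l by (auto dest: order_tendstoD)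
  then have "\<forall>\<^sub>F \<gamma> in at_right 0. u < h \<gamma> \<and> 0 < \<gamma>" using eventually_at_right_less[of "0::real"]
    by eventually_elim auto
  then obtain \<gamma> where \<gamma>: "u < h \<gamma>" "0 < \<gamma>"
    using eventually_happens'[OF trivial_limit_at_right_real] by blast
  define D where "D = \<beta> / (1 - \<beta>)"
  have "0 < D" using \<beta> by (simp add: D_def)
  then have "((\<lambda>d::real. d powr D) \<longlongrightarrow> 0) (at_right 0)" by real_asymp
  then have "((\<lambda>d. h \<gamma> - d powr (\<beta> / (1 - \<beta>)) * ln 2) \<longlongrightarrow> h \<gamma> - 0 * ln 2) (at_right 0)"
    unfolding D_def by (intro tendsto_intros)
  then have "\<forall>\<^sub>F d in at_right 0. u < h \<gamma> - d powr (\<beta> / (1 - \<beta>)) * ln 2"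
    using \<gamma> by (auto dest: order_tendstoD)
  then show "\<forall>\<^sub>F d in at_right 0. u < ?f d" using lower[OF \<gamma>(2)]
    by eventually_elim auto
qed

section \<open>Strong variation of cadlag paths\<close>

definition psum :: "real \<Rightarrow> (real \<Rightarrow> real) \<Rightarrow> (nat \<Rightarrow> real) \<Rightarrow> nat \<Rightarrow> real" where
  "psum p f t k = (\<Sum>j=1..k. \<bar>f (t j) - f (t (j - 1))\<bar> powr p)"

definition dyadic_sum :: "real \<Rightarrow> (real \<Rightarrow> real) \<Rightarrow> nat \<Rightarrow> real" where
  "dyadic_sum p f n = psum p f (\<lambda>j. real j / 2 ^ n) (2 ^ n)"

text \<open>Lists of natural numbers, rather than functions as in \<open>pvar_sup\<close>, make the
  index set countable, so that the supremum over it stays measurable. A bound on the last entry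
  suffices because the list is increasing.\<close>

definition dyadic_partitions :: "(nat \<times> nat list) set" where
  "dyadic_partitions = {(n, m). m \<noteq> [] \<and> sorted_wrt (<) m \<and> last m \<le> 2 ^ n}"

lemma sorted_last_dyadic:
  assumes "(n, m) \<in> dyadic_partitions" "i < length m" shows "m ! i \<le> 2 ^ n"
proof -
  have "m ! i \<le> m ! (length m - 1)"
    using assms by (cases "i = length m - 1")
      (auto simp: dyadic_partitions_def sorted_wrt_iff_nth_less intro!: less_imp_le)
  then show ?thesis using assms by (auto simp: dyadic_partitions_def last_conv_nth)
qed

lemma pvar_sup_alt:
  "pvar_sup p f = (SUP (k, t) \<in> {(k, t). (\<forall>j\<le>k. t j \<in> {0..1}) \<and> (\<forall>j<k. t j < t (Suc j))}. ennreal (psum p f t k))"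
  by (simp add: pvar_sup_def psum_def)

lemma psum_le_pvar_sup:
  assumes "\<And>j. j \<le> k \<Longrightarrow> t j \<in> {0..1}" "\<And>j. j < k \<Longrightarrow> t j < t (Suc j)"
  shows "ennreal (psum p f t k) \<le> pvar_sup p f"
  unfolding pvar_sup_alt by (rule SUP_upper2[of "(k, t)"]) (use assms in auto)

lemma psum_powr_subadditive:
  assumes p: "0 < p" "p \<le> (1::real)" and ab: "a \<le> (b::nat)"
  shows "\<bar>f b - f a\<bar> powr p \<le> (\<Sum>j\<in>{Suc a..b}. \<bar>f j - f (j - 1)\<bar> powr p)"
  using ab
proof (induction b rule: dec_induct)
  case base then show ?case by simp
next
  case (step b)
  \<comment> \<open>Division by x + y reduces this to r \<le> r^p on [0, 1], applied to two ratios
    that sum to 1.\<close>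
  have sub: "(x + y) powr p \<le> x powr p + y powr p" if "0 \<le> x" "0 \<le> y" for x y :: real
  proof (cases "x + y = 0")
    case False
    have "x / (x + y) \<le> (x / (x + y)) powr p" "y / (x + y) \<le> (y / (x + y)) powr p"
      using that p powr_mono'[of p 1 "x / (x+y)"] powr_mono'[of p 1 "y / (x+y)"]
      by (auto simp: divide_le_eq)
    moreover have "x / (x + y) + y / (x + y) = 1"
      using False by (simp add: add_divide_distrib[symmetric])
    ultimately have "1 \<le> (x / (x + y)) powr p + (y / (x + y)) powr p"
      by linarith
    then show ?thesis using that False by (simp add: powr_divide field_simps)
  qed (use that in auto)
  have "\<bar>f (Suc b) - f a\<bar> powr p \<le> (\<bar>f b - f a\<bar> + \<bar>f (Suc b) - f b\<bar>) powr p"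
    using p by (intro powr_mono2) auto
  also have "\<dots> \<le> \<bar>f b - f a\<bar> powr p + \<bar>f (Suc b) - f b\<bar> powr p" by (intro sub) auto
  also have "\<dots> \<le> (\<Sum>j\<in>{Suc a..b}. \<bar>f j - f (j - 1)\<bar> powr p) + \<bar>f (Suc b) - f b\<bar> powr p"
    using step.IH by simp
  finally show ?case using step.hyps by simp
qed

text \<open>Subadditivity bounds each increment by the sum over the grid cells that it spans, and
  the blocks of cells are disjoint. Weak monotonicity of \<open>m\<close> allows empty blocks, which
  contribute 0.\<close>

lemma dyadic_sum_ge:
  assumes p: "0 < p" "p \<le> 1"
    and m: "\<And>j. j < k \<Longrightarrow> m j \<le> m (Suc j)" "m k \<le> 2 ^ n"
  shows "psum p f (\<lambda>j. real (m j) / 2 ^ n) k \<le> dyadic_sum p f n"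
proof -
  let ?a = "\<lambda>i. \<bar>f (real i / 2 ^ n) - f (real (i - 1) / 2 ^ n)\<bar> powr p"
  have *: "psum p f (\<lambda>j. real (m j) / 2 ^ n) k \<le> (\<Sum>i\<in>{Suc (m 0)..m k}. ?a i) \<and> m 0 \<le> m k"
    using m(1)
  proof (induction k)
    case 0 then show ?case by (simp add: psum_def)
  next
    case (Suc k)
    have "psum p f (\<lambda>j. real (m j) / 2 ^ n) (Suc k) = psum p f (\<lambda>j. real (m j) / 2 ^ n) k +
       \<bar>f (real (m (Suc k)) / 2 ^ n) - f (real (m k) / 2 ^ n)\<bar> powr p" by (simp add: psum_def)
    also have "\<dots> \<le> (\<Sum>i\<in>{Suc (m 0)..m k}. ?a i) + (\<Sum>i\<in>{Suc (m k)..m (Suc k)}. ?a i)"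
      using Suc psum_powr_subadditive[OF p, of "m k" "m (Suc k)" "\<lambda>i. f (real i / 2 ^ n)"]
      by (intro add_mono) auto
    also have "\<dots> = (\<Sum>i\<in>{Suc (m 0)..m k} \<union> {Suc (m k)..m (Suc k)}. ?a i)"
      by (rule sum.union_disjoint[symmetric]) auto
    also have "{Suc (m 0)..m k} \<union> {Suc (m k)..m (Suc k)} = {Suc (m 0)..m (Suc k)}"
    proof -
      have "m 0 \<le> m k" "m k \<le> m (Suc k)" using Suc by auto
      then show ?thesis by auto
    qed
    finally show ?case using Suc.IH Suc.prems[of k] Suc.prems by fastforce
  qed
  note conjunct1[OF *]
  also have "(\<Sum>i\<in>{Suc (m 0)..m k}. ?a i) \<le> (\<Sum>i\<in>{1..2 ^ n}. ?a i)"
    using m(2) by (intro sum_mono2) auto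
  finally show ?thesis by (simp add: dyadic_sum_def psum_def)
qed

lemma dyadic_sum_incseq:
  assumes p: "0 < p" "p \<le> 1"
  shows "incseq (dyadic_sum p f)"
proof (rule incseq_SucI)
  fix n
  have "dyadic_sum p f n = psum p f (\<lambda>j. real (2 * j) / 2 ^ Suc n) (2 ^ n)"
    by (simp add: dyadic_sum_def)
  also have "\<dots> \<le> dyadic_sum p f (Suc n)"
    by (rule dyadic_sum_ge[OF p]) auto
  finally show "dyadic_sum p f n \<le> dyadic_sum p f (Suc n)" .
qed

text \<open>Partition points are rounded up to the dyadic grid, since only right limits of the
  path agree with its values.\<close>

lemma pvar_sup_dyadic:
  assumes c: "cadlag f" and p: "0 < p"
  shows "pvar_sup p f = (SUP (n, m) \<in> dyadic_partitions. ennreal (psum p f (\<lambda>j. real (m ! j) / 2 ^ n) (length m - 1)))"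
    (is "_ = ?S")
proof (rule antisym)
  show "pvar_sup p f \<le> ?S"
    unfolding pvar_sup_alt
  proof (rule SUP_least, clarify)
    fix k :: nat and t :: "nat \<Rightarrow> real"
    assume t: "\<forall>j\<le>k. t j \<in> {0..1}" "\<forall>j<k. t j < t (Suc j)"
    define m where "m n j = nat \<lceil>t j * 2 ^ n\<rceil>" for n j
    define d where "d n j = real (m n j) / 2 ^ n" for n j
    have d1: "t j \<le> d n j" "d n j < t j + 1 / 2 ^ n" "m n j \<le> 2 ^ n" if "j \<le> k" for j n
    proof -
      have "0 \<le> t j" "t j \<le> 1" using t that by auto
      then have m: "real (m n j) = of_int \<lceil>t j * 2 ^ n\<rceil>"
        by (simp add: m_def)
      have "t j * 2 ^ n \<le> real (m n j)" "real (m n j) < t j * 2 ^ n + 1"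
        unfolding m by linarith+
      then show "t j \<le> d n j" "d n j < t j + 1 / 2 ^ n" by (simp_all add: d_def field_simps)
      have "real (m n j) \<le> 2 ^ n"
        unfolding m using \<open>t j \<le> 1\<close> by (metis ceiling_le_iff mult.commute mult_left_le of_int_le_iff of_int_numeral of_int_power zero_le_numeral zero_le_power)
      then show "m n j \<le> 2 ^ n" by (metis of_nat_le_iff of_nat_numeral of_nat_power)
    qed
    have lim: "(\<lambda>n. d n j) \<longlonglongrightarrow> t j" if "j \<le> k" for j
    proof (rule tendsto_sandwich[of "\<lambda>_. t j" _ _ "\<lambda>n. t j + 1 / 2 ^ n"])
      have "(\<lambda>n. 1 / 2 ^ n :: real) \<longlonglongrightarrow> 0" by real_asymp
      then show "(\<lambda>n. t j + 1 / 2 ^ n) \<longlonglongrightarrow> t j" by (auto intro: tendsto_eq_intros)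
      show "\<forall>\<^sub>F n in sequentially. d n j \<le> t j + 1 / 2 ^ n"
        using d1(2)[OF that] by (intro always_eventually allI less_imp_le)
    qed (use d1 that in auto)
    have flim: "(\<lambda>n. f (d n j)) \<longlonglongrightarrow> f (t j)" if "j \<le> k" for j
    proof -
      have "(f \<longlongrightarrow> f (t j)) (at_right (t j))" using c t that by (auto simp: cadlag_def)
      \<comment> \<open>A rounded point may coincide with \<open>t j\<close>, so the limit is needed
        on the closed half-line.\<close>
      then have "(f \<longlongrightarrow> f (t j)) (at (t j) within {t j..})"
        by (auto simp: tendsto_def eventually_at_filter elim!: eventually_mono)
      then have "continuous (at (t j) within {t j..}) f" by (simp add: continuous_within)
      from continuous_within_tendsto_compose[OF this _ lim[OF that]] d1[OF that] show ?thesis by simp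
    qed
    have "(\<lambda>n. psum p f (d n) k) \<longlonglongrightarrow> psum p f t k"
      unfolding psum_def using p by (intro tendsto_intros tendsto_powr' flim) auto
    then have "(\<lambda>n. ennreal (psum p f (d n) k)) \<longlonglongrightarrow> ennreal (psum p f t k)" by simp
    moreover have "\<forall>\<^sub>F n in sequentially. ennreal (psum p f (d n) k) \<le> ?S"
    proof -
      have "\<forall>\<^sub>F n in sequentially. \<forall>j\<in>{..<k}. d n j < d n (Suc j)"
      proof (intro eventually_ball_finite ballI)
        fix j assume j: "j \<in> {..<k}"
        \<comment> \<open>Rounding can merge neighbouring points, but a value \<open>s\<close>
          strictly between them separates their rounded versions for all large
          \<open>n\<close>.\<close>
        obtain s where s: "t j < s" "s < t (Suc j)" using t(2) j dense[of "t j" "t (Suc j)"] by auto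
        have "\<forall>\<^sub>F n in sequentially. d n j < s" using lim[of j] s j by (auto intro: order_tendstoD)
        moreover have "\<forall>\<^sub>F n in sequentially. s < d n (Suc j)" using lim[of "Suc j"] s j by (auto intro: order_tendstoD)
        ultimately show "\<forall>\<^sub>F n in sequentially. d n j < d n (Suc j)" by eventually_elim auto
      qed simp
      then show ?thesis
      proof eventually_elim
        fix n assume "\<forall>j\<in>{..<k}. d n j < d n (Suc j)"
        then have ms: "\<And>j. j < k \<Longrightarrow> m n j < m n (Suc j)" by (auto simp: d_def divide_less_cancel)
        let ?m = "map (m n) [0..<Suc k]"
        have "m n i < m n j" if "i < j" "j \<le> k" for i j
          using that
          proof (induction j)
            case (Suc j)
            then show ?case using ms[of j] by (cases "i = j") auto
          qed simp
        then have "(n, ?m) \<in> dyadic_partitions"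
          using d1(3)[of k n] by (auto simp: dyadic_partitions_def sorted_wrt_iff_nth_less last_map nth_append simp del: upt_Suc)
        moreover have "psum p f (d n) k = psum p f (\<lambda>j. real (?m ! j) / 2 ^ n) (length ?m - 1)"
          unfolding psum_def d_def by (rule sum.cong) (auto simp del: upt_Suc)
        ultimately show "ennreal (psum p f (d n) k) \<le> ?S"
          by (intro SUP_upper2[of "(n, ?m)"]) (auto simp del: upt_Suc)
      qed
    qed
    ultimately show "ennreal (psum p f t k) \<le> ?S"
      by (rule tendsto_upperbound) simp
  qed
  show "?S \<le> pvar_sup p f"
  proof (rule SUP_least, clarify)
    fix n m assume "(n, m) \<in> dyadic_partitions"
    then show "ennreal (psum p f (\<lambda>j. real (m ! j) / 2 ^ n) (length m - 1)) \<le> pvar_sup p f"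
    proof (intro psum_le_pvar_sup)
      fix j assume nm: "(n, m) \<in> dyadic_partitions"
      { assume "j \<le> length m - 1"
        then have "j < length m" using nm by (cases m) (auto simp: dyadic_partitions_def)
        then have "real (m ! j) \<le> real (2 ^ n)" using sorted_last_dyadic[OF nm] of_nat_le_iff by blast
        then show "real (m ! j) / 2 ^ n \<in> {0..1}" by simp }
      assume "j < length m - 1"
      then show "real (m ! j) / 2 ^ n < real (m ! Suc j) / 2 ^ n"
        using nm by (auto simp: dyadic_partitions_def sorted_wrt_iff_nth_less divide_less_cancel)
    qed
  qed
qed

lemma pvar_sup_LIMSEQ:
  assumes c: "cadlag f" and p: "0 < p" "p \<le> 1"
  shows "(\<lambda>n. ennreal (dyadic_sum p f n)) \<longlonglongrightarrow> pvar_sup p f"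
proof -
  have "pvar_sup p f = (SUP n. ennreal (dyadic_sum p f n))"
  proof (rule antisym)
    show "pvar_sup p f \<le> (SUP n. ennreal (dyadic_sum p f n))"
      unfolding pvar_sup_dyadic[OF c p(1)]
    proof (rule SUP_least, clarify)
      fix n m assume nm: "(n, m) \<in> dyadic_partitions"
      have "psum p f (\<lambda>j. real (m ! j) / 2 ^ n) (length m - 1) \<le> dyadic_sum p f n"
        using nm by (intro dyadic_sum_ge p)
          (auto simp: dyadic_partitions_def sorted_wrt_iff_nth_less last_conv_nth order_le_less)
      then show "ennreal (psum p f (\<lambda>j. real (m ! j) / 2 ^ n) (length m - 1)) \<le> (SUP n. ennreal (dyadic_sum p f n))"
        by (intro SUP_upper2[of n]) (auto intro!: ennreal_leI)
    qed
    show "(SUP n. ennreal (dyadic_sum p f n)) \<le> pvar_sup p f"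
      unfolding dyadic_sum_def
      by (rule SUP_least, rule psum_le_pvar_sup) (auto simp: divide_less_cancel power_le_one_iff)
  qed
  moreover have "incseq (\<lambda>n. ennreal (dyadic_sum p f n))"
    using dyadic_sum_incseq[OF p] by (auto simp: incseq_def intro!: ennreal_leI)
  ultimately show ?thesis using LIMSEQ_SUP by metis
qed

section \<open>Exponents at least 1 and monotone paths\<close>

lemma sum_powr_le_powr_sum:
  fixes a :: "'b \<Rightarrow> real"
  assumes "finite A" "\<And>i. i \<in> A \<Longrightarrow> 0 \<le> a i" "1 \<le> p"
  shows "(\<Sum>i\<in>A. a i powr p) \<le> (\<Sum>i\<in>A. a i) powr p"
proof (cases "(\<Sum>i\<in>A. a i) = 0")
  case True
  then have "\<forall>i\<in>A. a i = 0" using assms sum_nonneg_eq_0_iff by blast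
  then show ?thesis using assms by simp
next
  case False
  let ?s = "\<Sum>i\<in>A. a i"
  have s: "0 < ?s" using False assms by (simp add: order_less_le sum_nonneg)
  \<comment> \<open>The ratio of \<open>a i\<close> to the total lies in [0, 1], where raising to a
    power of at least 1 does not increase.\<close>
  have "a i powr p \<le> a i / ?s * ?s powr p" if "i \<in> A" for i
  proof -
    have 1: "a i \<le> ?s" using assms that by (intro member_le_sum) auto
    have "(a i / ?s) powr p \<le> (a i / ?s) powr 1"
      using 1 s assms that by (intro powr_mono') auto
    then show ?thesis using s assms that by (simp add: powr_divide field_simps)
  qed
  then have "(\<Sum>i\<in>A. a i powr p) \<le> (\<Sum>i\<in>A. a i / ?s * ?s powr p)" by (rule sum_mono)
  also have "\<dots> = ?s powr p" using s by (simp add: sum_distrib_right[symmetric] sum_divide_distrib[symmetric])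
  finally show ?thesis .
qed

text \<open>The increments telescope, so every power sum is at most (f 1 - f 0)^p, and the partition
  0 < 1 attains this; the value does not depend on \<open>p\<close>. The start \<open>f 0\<close> is
  kept since a Levy process starts at 0 only almost surely.\<close>

lemma strong_pvar_mono:
  assumes f: "\<And>s t. 0 \<le> s \<Longrightarrow> s \<le> t \<Longrightarrow> f s \<le> f t" and p: "1 \<le> p"
  shows "strong_pvar p f = ennreal (f 1 - f 0)"
proof -
  have "pvar_sup p f = ennreal ((f 1 - f 0) powr p)"
  proof (rule antisym)
    show "pvar_sup p f \<le> ennreal ((f 1 - f 0) powr p)"
      unfolding pvar_sup_alt
    proof (rule SUP_least, clarify)
      fix k :: nat and t :: "nat \<Rightarrow> real"
      assume t: "\<forall>j\<le>k. t j \<in> {0..1}" "\<forall>j<k. t j < t (Suc j)"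
      have inc: "f (t (j - 1)) \<le> f (t j)" if "j \<in> {1..k}" for j
      proof -
        obtain i where "j = Suc i" using \<open>j \<in> {1..k}\<close> by (cases j) auto
        then show ?thesis using t that by (intro f) (auto intro!: less_imp_le)
      qed
      have "psum p f t k \<le> (\<Sum>j=1..k. \<bar>f (t j) - f (t (j - 1))\<bar>) powr p"
        unfolding psum_def using p by (intro sum_powr_le_powr_sum) auto
      also have "(\<Sum>j=1..k. \<bar>f (t j) - f (t (j - 1))\<bar>) = (\<Sum>j=1..k. f (t j) - f (t (j - 1)))"
        by (intro sum.cong refl) (use inc in auto)
      also have "\<dots> = f (t k) - f (t 0)" by (induction k) auto
      also have "\<dots> powr p \<le> (f 1 - f 0) powr p"
      proof (rule powr_mono2)
        have "f (t 0) \<le> f (t k)" using inc by (induction k) (fastforce)+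
        then show "0 \<le> f (t k) - f (t 0)" by simp
        have "f (t k) \<le> f 1" "f 0 \<le> f (t 0)" using t by (auto intro!: f)
        then show "f (t k) - f (t 0) \<le> f 1 - f 0" by simp
      qed (use p in auto)
      finally show "ennreal (psum p f t k) \<le> ennreal ((f 1 - f 0) powr p)" by (rule ennreal_leI)
    qed
    have "ennreal (psum p f real 1) \<le> pvar_sup p f" by (rule psum_le_pvar_sup) auto
    then show "ennreal ((f 1 - f 0) powr p) \<le> pvar_sup p f"
      using f[of 0 1] by (simp add: psum_def)
  qed
  then show ?thesis using p f[of 0 1] by (simp add: strong_pvar_def powr_powr)
qed

lemma strong_pvar_uminus: "strong_pvar p (\<lambda>t. - f t) = strong_pvar p f"
proof -
  have "psum p (\<lambda>t. - f t) = psum p f" by (intro ext) (simp add: psum_def abs_minus_commute)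
  then show ?thesis by (simp add: strong_pvar_def pvar_sup_alt)
qed

lemma strong_pvar_le_iff:
  assumes "0 < p" "0 < e"
  shows "strong_pvar p f \<le> ennreal e \<longleftrightarrow> pvar_sup p f \<le> ennreal (e powr p)"
proof (cases "pvar_sup p f")
  case (real r)
  have "r powr (1 / p) \<le> e \<longleftrightarrow> r \<le> e powr p"
  proof
    assume "r powr (1 / p) \<le> e"
    then have "(r powr (1 / p)) powr p \<le> e powr p" using assms by (intro powr_mono2) auto
    then show "r \<le> e powr p" using assms real by (simp add: powr_powr)
  next
    assume "r \<le> e powr p"
    then have "r powr (1 / p) \<le> (e powr p) powr (1 / p)" using assms real by (intro powr_mono2) auto
    then show "r powr (1 / p) \<le> e" using assms by (simp add: powr_powr)
  qed
  then show ?thesis using real assms by (simp add: strong_pvar_def)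
qed (simp add: strong_pvar_def top.extremum_unique)

section \<open>Truncated absolute values as mixtures of cosines\<close>

text \<open>Up to a factor this is the Fourier transform of the triangle max 0 (s - |z|), a Fejer
  kernel. At x = 0 division by zero gives the value 0, on a null set.\<close>

definition cos_kernel :: "real \<Rightarrow> real \<Rightarrow> real" where
  "cos_kernel s x = (1 - cos (s * x)) / x\<^sup>2"

lemma cos_kernel_nonneg[simp]: "0 \<le> cos_kernel s x"
  by (simp add: cos_kernel_def)

lemma cos_kernel_measurable[measurable]: "cos_kernel s \<in> borel_measurable borel"
  unfolding cos_kernel_def by measurable

lemma one_minus_cos_le: "1 - cos x \<le> x\<^sup>2 / (2::real)"
proof -
  have "1 - cos x = 2 * (sin (x / 2))\<^sup>2" using cos_double_sin[of "x / 2"] by simp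
  also have "\<dots> \<le> 2 * (\<bar>x / 2\<bar>)\<^sup>2"
    using abs_sin_x_le_abs_x[of "x / 2"] by (simp only: abs_le_square_iff power2_abs)
  finally show ?thesis by (simp add: power2_eq_square)
qed

lemma cos_kernel_bound: "cos_kernel 1 x \<le> 5 / 2 * inverse (1 + x\<^sup>2)"
proof (cases "x = 0")
  case False
  \<comment> \<open>The bound 1 - cos x \<le> x^2 / 2 takes care of the summand 1, and 1 - cos x
    \<le> 2 of the summand x^2; hence 5 / 2 = 1 / 2 + 2.\<close>
  have "(1 - cos x) * (1 + x\<^sup>2) \<le> 5 / 2 * x\<^sup>2"
    using one_minus_cos_le[of x] mult_right_mono[of "1 - cos x" 2 "x\<^sup>2"]
    by (simp add: algebra_simps) (use cos_ge_minus_one[of x] in linarith)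
  then show ?thesis using False by (simp add: cos_kernel_def field_simps add_pos_nonneg)
qed (simp add: cos_kernel_def)

lemma integrable_cos_kernel_1: "integrable lborel (cos_kernel 1)"
proof (rule Bochner_Integration.integrable_bound)
  have "set_integrable lborel (einterval (-\<infinity>) \<infinity>) (\<lambda>x. inverse (1 + x\<^sup>2))"
    by (rule integrable_inverse_1_plus_square)
  then show "integrable lborel (\<lambda>x::real. 5 / 2 * inverse (1 + x\<^sup>2))"
    by (simp add: set_integrable_def einterval_def)
qed (use cos_kernel_bound in \<open>auto simp: abs_of_nonneg intro: order_trans\<close>)

text \<open>The classical value is pi. It enters as a normalising divisor, for which positivity
  suffices.\<close>

definition cos_kernel_mass :: real where "cos_kernel_mass = (\<integral>x. cos_kernel 1 x \<partial>lborel)"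

lemma cos_kernel_mass_pos: "0 < cos_kernel_mass"
proof -
  have "0 \<le> cos_kernel_mass" by (simp add: cos_kernel_mass_def)
  moreover have "cos_kernel_mass \<noteq> 0"
  proof
    assume "cos_kernel_mass = 0"
    then have "AE x in lborel. cos_kernel 1 x = 0"
      using integral_nonneg_eq_0_iff_AE[OF integrable_cos_kernel_1] by (simp add: cos_kernel_mass_def)
    then have "AE x in lborel. x \<notin> {0<..<1::real}"
    proof (rule AE_mp, intro AE_I2 impI)
      fix x :: real assume "cos_kernel 1 x = 0"
      then have "x = 0 \<or> cos x = 1" by (auto simp: cos_kernel_def)
      then show "x \<notin> {0<..<1::real}" using cos_monotone_0_pi[of 0 x] pi_gt3 by auto
    qed
    then have "emeasure lborel {0<..<1::real} = 0"
      by (subst (asm) AE_iff_measurable[of "{0<..<1}"]) auto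
    then show False by simp
  qed
  ultimately show ?thesis by simp
qed

text \<open>Scaling reduces to s = 1. The formula represents |s| as a mixture of the functions 1 -
  cos (x s).\<close>

lemma has_integral_cos_kernel:
  "has_bochner_integral lborel (cos_kernel s) (cos_kernel_mass * \<bar>s\<bar>)"
proof (cases "s = 0")
  case False
  have "has_bochner_integral lborel (cos_kernel 1) cos_kernel_mass"
    using integrable_cos_kernel_1 by (simp add: has_bochner_integral_iff cos_kernel_mass_def)
  from lborel_has_bochner_integral_real_affine_iff[OF False, THEN iffD1, OF this, of 0]
  have "has_bochner_integral lborel (\<lambda>x. cos_kernel 1 (s * x)) (cos_kernel_mass / \<bar>s\<bar>)" by (simp add: divide_inverse mult.commute)
  then have "has_bochner_integral lborel (\<lambda>x. s\<^sup>2 * cos_kernel 1 (s * x)) (s\<^sup>2 * (cos_kernel_mass / \<bar>s\<bar>))"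
    by (rule has_bochner_integral_mult_right)
  moreover have "s\<^sup>2 * cos_kernel 1 (s * x) = cos_kernel s x" for x
    using False by (simp add: cos_kernel_def power_mult_distrib)
  moreover have "s\<^sup>2 * (cos_kernel_mass / \<bar>s\<bar>) = cos_kernel_mass * \<bar>s\<bar>"
    using False by (simp add: power2_eq_square field_simps abs_mult_self_eq)
  ultimately show ?thesis by simp
qed (simp add: cos_kernel_def[abs_def] has_bochner_integral_zero)

text \<open>Product-to-sum formulas turn the integrand into \<open>cos_kernel\<close> terms at z, s,
  z + s and z - s, and |z| + |s| - (|z + s| + |z - s|) / 2 = min |z| |s|.\<close>

lemma has_integral_cos_kernel_mult:
  "has_bochner_integral lborel (\<lambda>x. (1 - cos (z * x)) * cos_kernel s x) (cos_kernel_mass * min \<bar>z\<bar> \<bar>s\<bar>)"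
proof -
  have "(1 - cos (z * x)) * cos_kernel s x =
     cos_kernel z x + cos_kernel s x - (1 / 2) * (cos_kernel (z + s) x + cos_kernel (z - s) x)" for x
    by (cases "x = 0") (simp_all add: cos_kernel_def cos_add cos_diff field_simps)
  moreover have "has_bochner_integral lborel (\<lambda>x. cos_kernel z x + cos_kernel s x - (1 / 2) * (cos_kernel (z + s) x + cos_kernel (z - s) x))
      (cos_kernel_mass * \<bar>z\<bar> + cos_kernel_mass * \<bar>s\<bar> - (1 / 2) * (cos_kernel_mass * \<bar>z + s\<bar> + cos_kernel_mass * \<bar>z - s\<bar>))"
    by (intro has_bochner_integral_diff has_bochner_integral_add has_bochner_integral_mult_right has_integral_cos_kernel)
  moreover have "cos_kernel_mass * \<bar>z\<bar> + cos_kernel_mass * \<bar>s\<bar> - (1 / 2) * (cos_kernel_mass * \<bar>z + s\<bar> + cos_kernel_mass * \<bar>z - s\<bar>) =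
      cos_kernel_mass * (\<bar>z\<bar> + \<bar>s\<bar> - (1 / 2) * (\<bar>z + s\<bar> + \<bar>z - s\<bar>))"
    by (simp add: algebra_simps)
  moreover have "\<bar>z\<bar> + \<bar>s\<bar> - (1 / 2) * (\<bar>z + s\<bar> + \<bar>z - s\<bar>) = min \<bar>z\<bar> \<bar>s\<bar>"
    by (simp add: min_def abs_if)
  ultimately show ?thesis by simp
qed

lemma norm_one_minus_iexp: "cmod (1 - iexp y) \<le> min \<bar>y\<bar> 2"
proof -
  have "cmod (iexp y - 1) \<le> \<bar>y\<bar>" using iexp_approx1[of y 0] by simp
  moreover have "cmod (1 - iexp y) \<le> 2" using norm_triangle_ineq4[of 1 "iexp y"] by simp
  ultimately show ?thesis by (simp add: norm_minus_commute)
qed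

text \<open>Multiplying 1 - iexp (x z) by iexp (- x y) moves the centre of the truncated absolute
  value from 0 to y. The term min |y| s comes out of the same product and makes the integrand vanish
  at z = 0, as integration against a Levy measure requires. \<open>N\<close> stays general because
  it will be both \<nu>, with inner integral \<Psi>, and the law of \<open>Z t\<close>, with inner
  integral 1 - exp (- t \<Psi>).\<close>

lemma integral_bump:
  fixes N :: "real measure" and y s :: real
  assumes N: "sigma_finite_measure N" and sets[measurable_cong, simp]: "sets N = sets borel" and s: "0 \<le> s"
    and fin: "(\<integral>\<^sup>+x. (\<integral>\<^sup>+z. ennreal (min \<bar>x * z\<bar> 2) \<partial>N) * ennreal (cos_kernel s x) \<partial>lborel) < \<infinity>"
  shows "integrable N (\<lambda>z. min \<bar>z - y\<bar> s - min \<bar>y\<bar> s)"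
    and "(\<integral>z. min \<bar>z - y\<bar> s - min \<bar>y\<bar> s \<partial>N) =
      (\<integral>x. Re (iexp (- (x * y)) * (\<integral>z. 1 - iexp (x * z) \<partial>N)) * cos_kernel s x \<partial>lborel) / cos_kernel_mass"
proof -
  interpret N: sigma_finite_measure N by fact
  interpret pair_sigma_finite lborel N by standard
  let ?f = "\<lambda>x z. iexp (- (x * y)) * (1 - iexp (x * z)) * cos_kernel s x"
  have norm: "ennreal (norm (?f x z)) \<le> ennreal (min \<bar>x * z\<bar> 2) * ennreal (cos_kernel s x)" for x z
    using norm_one_minus_iexp[of "x * z"]
    by (subst ennreal_mult[symmetric]) (auto simp: norm_mult intro!: ennreal_leI mult_right_mono)
  have int: "integrable (lborel \<Otimes>\<^sub>M N) (\<lambda>(x, z). ?f x z)"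
  proof (rule integrableI_bounded)
    have "(\<integral>\<^sup>+w. ennreal (norm (case w of (x, z) \<Rightarrow> ?f x z)) \<partial>(lborel \<Otimes>\<^sub>M N)) =
      (\<integral>\<^sup>+x. \<integral>\<^sup>+z. ennreal (norm (?f x z)) \<partial>N \<partial>lborel)"
      by (subst N.nn_integral_fst[symmetric]) auto
    also have "\<dots> \<le> (\<integral>\<^sup>+x. \<integral>\<^sup>+z. ennreal (min \<bar>x * z\<bar> 2) * ennreal (cos_kernel s x) \<partial>N \<partial>lborel)"
      by (intro nn_integral_mono norm)
    also have "\<dots> = (\<integral>\<^sup>+x. (\<integral>\<^sup>+z. ennreal (min \<bar>x * z\<bar> 2) \<partial>N) * ennreal (cos_kernel s x) \<partial>lborel)"
      by (intro nn_integral_cong nn_integral_multc) simp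
    finally show "(\<integral>\<^sup>+w. ennreal (norm (case w of (x, z) \<Rightarrow> ?f x z)) \<partial>(lborel \<Otimes>\<^sub>M N)) < \<infinity>"
      using fin by (rule order_le_less_trans)
  qed measurable
  have in1: "(\<integral>x. Re (?f x z) \<partial>lborel) = cos_kernel_mass * (min \<bar>z - y\<bar> s - min \<bar>y\<bar> s)" for z
  proof -
    \<comment> \<open>Apart from the kernel, the real part is cos (y x) - cos ((z - y) x), a
      difference of two terms of the form 1 - cos.\<close>
    have eq: "Re (?f x z) = (1 - cos ((z - y) * x)) * cos_kernel s x - (1 - cos (y * x)) * cos_kernel s x" for x
      by (simp add: Re_exp Im_exp cos_diff algebra_simps)
    have "has_bochner_integral lborel (\<lambda>x. Re (?f x z)) (cos_kernel_mass * min \<bar>z - y\<bar> \<bar>s\<bar> - cos_kernel_mass * min \<bar>y\<bar> \<bar>s\<bar>)"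
      unfolding eq by (intro has_bochner_integral_diff has_integral_cos_kernel_mult)
    then show ?thesis using s by (simp add: has_bochner_integral_iff algebra_simps)
  qed
  have re: "integrable (lborel \<Otimes>\<^sub>M N) (\<lambda>(x, z). Re (?f x z))"
    using integrable_Re[OF int] by (simp add: case_prod_unfold)
  have "integrable N (\<lambda>z. \<integral>x. Re (?f x z) \<partial>lborel)" using integrable_snd[OF re] .
  then have "integrable N (\<lambda>z. cos_kernel_mass * (min \<bar>z - y\<bar> s - min \<bar>y\<bar> s))" unfolding in1 .
  then show "integrable N (\<lambda>z. min \<bar>z - y\<bar> s - min \<bar>y\<bar> s)"
    using cos_kernel_mass_pos by simp
  have "cos_kernel_mass * (\<integral>z. min \<bar>z - y\<bar> s - min \<bar>y\<bar> s \<partial>N) = (\<integral>z. (\<integral>x. Re (?f x z) \<partial>lborel) \<partial>N)"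
    unfolding in1 by simp
  also have "\<dots> = (\<integral>x. (\<integral>z. Re (?f x z) \<partial>N) \<partial>lborel)" by (rule Fubini_integral[OF re])
  also have "\<dots> = (\<integral>x. Re (iexp (- (x * y)) * (\<integral>z. 1 - iexp (x * z) \<partial>N)) * cos_kernel s x \<partial>lborel)"
  proof (rule integral_cong_AE)
    have "AE x in lborel. integrable N (\<lambda>z. ?f x z)" using AE_integrable_fst[OF int] .
    then show "AE x in lborel. (\<integral>z. Re (?f x z) \<partial>N) = Re (iexp (- (x * y)) * (\<integral>z. 1 - iexp (x * z) \<partial>N)) * cos_kernel s x"
    proof eventually_elim
      fix x assume i: "integrable N (\<lambda>z. ?f x z)"
      have "(\<integral>z. Re (?f x z) \<partial>N) = Re (\<integral>z. ?f x z \<partial>N)" using integral_Re[OF i] by simp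
      also have "(\<integral>z. ?f x z \<partial>N) = iexp (- (x * y)) * (\<integral>z. 1 - iexp (x * z) \<partial>N) * cos_kernel s x"
        by simp
      finally show "(\<integral>z. Re (?f x z) \<partial>N) = Re (iexp (- (x * y)) * (\<integral>z. 1 - iexp (x * z) \<partial>N)) * cos_kernel s x"
        by (simp only: Re_complex_of_real times_complex.sel Im_complex_of_real mult_zero_right diff_zero)
    qed
  qed measurable
  finally show "(\<integral>z. min \<bar>z - y\<bar> s - min \<bar>y\<bar> s \<partial>N) =
      (\<integral>x. Re (iexp (- (x * y)) * (\<integral>z. 1 - iexp (x * z) \<partial>N)) * cos_kernel s x \<partial>lborel) / cos_kernel_mass"
    using cos_kernel_mass_pos by (simp add: field_simps)
qed

section \<open>Integrals against the stable Levy measure\<close>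

lemma nn_integral_half_line:
  assumes [measurable]: "f \<in> borel_measurable borel"
  shows "(\<integral>\<^sup>+x. f x \<partial>lborel) = (\<integral>\<^sup>+x. (f x + f (- x)) * indicator {0<..} (x::real) \<partial>lborel)"
proof -
  have "(\<integral>\<^sup>+x. f x \<partial>lborel) = (\<integral>\<^sup>+x. f x * indicator {0<..} x + f x * indicator {..<0} x \<partial>lborel)"
  proof (rule nn_integral_cong_AE)
    show "AE x in lborel. f x = f x * indicator {0<..} x + f x * indicator {..<0} x"
      using AE_lborel_singleton[of 0] by eventually_elim (auto simp: indicator_def)
  qed
  also have "\<dots> = (\<integral>\<^sup>+x. f x * indicator {0<..} x \<partial>lborel) + (\<integral>\<^sup>+x. f x * indicator {..<0} x \<partial>lborel)"
    by (rule nn_integral_add) auto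
  also have "(\<integral>\<^sup>+x. f x * indicator {..<0} x \<partial>lborel) = (\<integral>\<^sup>+x. f (- x) * indicator {0<..} x \<partial>lborel)"
    by (subst nn_integral_real_affine[where c="-1" and t=0]) (auto intro!: nn_integral_cong simp: indicator_def)
  also have "(\<integral>\<^sup>+x. f x * indicator {0<..} x \<partial>lborel) + \<dots> = (\<integral>\<^sup>+x. f x * indicator {0<..} x + f (- x) * indicator {0<..} x \<partial>lborel)"
    by (rule nn_integral_add[symmetric]) auto
  finally show ?thesis by (simp add: distrib_right)
qed

lemma nn_integral_powr_tail:
  fixes e u :: real
  assumes "e < -1" "0 < u"
  shows "(\<integral>\<^sup>+x. ennreal (x powr e) * indicator {u..} x \<partial>lborel) = ennreal (- (u powr (e + 1)) / (e + 1))"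
  by (rule nn_integral_has_integral_lebesgue') (use has_integral_powr_to_inf[OF assms] in auto)

lemma sets_stable_levy_measure[measurable_cong, simp]: "sets (stable_levy_measure \<alpha> a b) = sets borel"
  by (simp add: stable_levy_measure_def)

lemma space_stable_levy_measure[simp]: "space (stable_levy_measure \<alpha> a b) = UNIV"
  by (simp add: stable_levy_measure_def)

lemma sigma_finite_stable_levy_measure: "sigma_finite_measure (stable_levy_measure \<alpha> a b)"
  unfolding stable_levy_measure_def
  by (subst sigma_finite_measure.sigma_finite_iff_density_finite[OF sigma_finite_lborel]) auto

text \<open>Folding the two half-lines onto one adds the densities; this is the origin of the sum of
  the two coefficients in all constants.\<close>

lemma nn_integral_stable_even:
  assumes [measurable]: "f \<in> borel_measurable borel" and "0 \<le> a" "0 \<le> b"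
  shows "(\<integral>\<^sup>+z. f \<bar>z\<bar> \<partial>stable_levy_measure \<alpha> a b) =
    ennreal (a + b) * (\<integral>\<^sup>+r. f r * ennreal (r powr (- \<alpha> - 1)) * indicator {0<..} r \<partial>lborel)"
proof -
  let ?d = "\<lambda>z. ennreal (a * z powr (-\<alpha> - 1) * indicator {0<..} z + b * \<bar>z\<bar> powr (-\<alpha> - 1) * indicator {..<0} z)"
  have "(\<integral>\<^sup>+z. f \<bar>z\<bar> \<partial>stable_levy_measure \<alpha> a b) = (\<integral>\<^sup>+z. ?d z * f \<bar>z\<bar> \<partial>lborel)"
    unfolding stable_levy_measure_def by (rule nn_integral_density) auto
  also have "\<dots> = (\<integral>\<^sup>+z. (?d z * f \<bar>z\<bar> + ?d (- z) * f \<bar>- z\<bar>) * indicator {0<..} z \<partial>lborel)"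
    by (rule nn_integral_half_line) measurable
  also have "\<dots> = (\<integral>\<^sup>+r. ennreal (a + b) * (f r * ennreal (r powr (- \<alpha> - 1)) * indicator {0<..} r) \<partial>lborel)"
  proof (rule nn_integral_cong)
    fix z :: real
    show "(?d z * f \<bar>z\<bar> + ?d (- z) * f \<bar>- z\<bar>) * indicator {0<..} z = ennreal (a + b) * (f z * ennreal (z powr (- \<alpha> - 1)) * indicator {0<..} z)"
      using assms(2,3) by (auto simp: indicator_def ennreal_mult distrib_right[symmetric] mult_ac)
  qed
  also have "\<dots> = ennreal (a + b) * (\<integral>\<^sup>+r. f r * ennreal (r powr (- \<alpha> - 1)) * indicator {0<..} r \<partial>lborel)"
    by (rule nn_integral_cmult) measurable
  finally show ?thesis .
qed

lemma stable_tail: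
  assumes "0 < \<alpha>" "0 \<le> a" "0 \<le> b" "0 < u"
  shows "(\<integral>\<^sup>+z. indicator {u..} \<bar>z\<bar> \<partial>stable_levy_measure \<alpha> a b) = ennreal ((a + b) / \<alpha> * u powr (- \<alpha>))"
proof -
  have "(\<integral>\<^sup>+r. indicator {u..} r * ennreal (r powr (- \<alpha> - 1)) * indicator {0<..} r \<partial>lborel) =
     (\<integral>\<^sup>+r. ennreal (r powr (- \<alpha> - 1)) * indicator {u..} r \<partial>lborel)"
    using assms by (intro nn_integral_cong) (auto simp: indicator_def)
  also have "\<dots> = ennreal (- (u powr ((- \<alpha> - 1) + 1)) / ((- \<alpha> - 1) + 1))"
    by (rule nn_integral_powr_tail) (use assms in auto)
  finally show ?thesis
    using assms by (subst nn_integral_stable_even) (auto simp del: ennreal_plus simp flip: ennreal_mult)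
qed

text \<open>Tonelli combined with the tail (a + b) / \<alpha> * u^(- \<alpha>) of the Levy measure.
  \<open>G\<close> stands for the derivative of the function of |z| that is to be
  integrated.\<close>

lemma stable_layer_cake:
  assumes [measurable]: "G \<in> borel_measurable borel" and "0 < \<alpha>" "0 \<le> a" "0 \<le> b"
  shows "(\<integral>\<^sup>+z. (\<integral>\<^sup>+u. G u * indicator {0<..\<bar>z\<bar>} u \<partial>lborel) \<partial>stable_levy_measure \<alpha> a b) =
    (\<integral>\<^sup>+u. G u * ennreal ((a + b) / \<alpha> * u powr (- \<alpha>)) * indicator {0<..} u \<partial>lborel)"
proof -
  interpret N: sigma_finite_measure "stable_levy_measure \<alpha> a b" by (rule sigma_finite_stable_levy_measure)
  interpret pair_sigma_finite "stable_levy_measure \<alpha> a b" lborel by standard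
  have "(\<integral>\<^sup>+z. (\<integral>\<^sup>+u. G u * indicator {0<..\<bar>z\<bar>} u \<partial>lborel) \<partial>stable_levy_measure \<alpha> a b) =
    (\<integral>\<^sup>+z. (\<integral>\<^sup>+u. G u * indicator {0<..} u * indicator {u..} \<bar>z\<bar> \<partial>lborel) \<partial>stable_levy_measure \<alpha> a b)"
    by (intro nn_integral_cong) (auto simp: indicator_def)
  also have "\<dots> = (\<integral>\<^sup>+u. (\<integral>\<^sup>+z. G u * indicator {0<..} u * indicator {u..} \<bar>z\<bar> \<partial>stable_levy_measure \<alpha> a b) \<partial>lborel)"
    by (rule Fubini'[symmetric]) (unfold indicator_def atLeast_iff, measurable)
  also have "\<dots> = (\<integral>\<^sup>+u. G u * ennreal ((a + b) / \<alpha> * u powr (- \<alpha>)) * indicator {0<..} u \<partial>lborel)"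
  proof (rule nn_integral_cong)
    fix u :: real
    have "(\<integral>\<^sup>+z. G u * indicator {0<..} u * indicator {u..} \<bar>z\<bar> \<partial>stable_levy_measure \<alpha> a b) =
       G u * indicator {0<..} u * (\<integral>\<^sup>+z. indicator {u..} \<bar>z\<bar> \<partial>stable_levy_measure \<alpha> a b)"
      by (rule nn_integral_cmult) measurable
    also have "\<dots> = G u * ennreal ((a + b) / \<alpha> * u powr (- \<alpha>)) * indicator {0<..} u"
      using assms by (cases "0 < u") (simp_all add: stable_tail)
    finally show "(\<integral>\<^sup>+z. G u * indicator {0<..} u * indicator {u..} \<bar>z\<bar> \<partial>stable_levy_measure \<alpha> a b) =
      G u * ennreal ((a + b) / \<alpha> * u powr (- \<alpha>)) * indicator {0<..} u" .
  qed
  finally show ?thesis .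
qed

text \<open>Layer cake for the derivative of min |z| s, the indicator of u \<le> s; \<alpha> < 1
  makes u^(- \<alpha>) integrable at 0.\<close>

lemma nn_integral_stable_min:
  assumes \<alpha>: "0 < \<alpha>" "\<alpha> < 1" and ab: "0 \<le> a" "0 \<le> b" and s: "0 \<le> s"
  shows "(\<integral>\<^sup>+z. ennreal (min \<bar>z\<bar> s) \<partial>stable_levy_measure \<alpha> a b) = ennreal ((a + b) / (\<alpha> * (1 - \<alpha>)) * s powr (1 - \<alpha>))"
proof -
  have eq: "ennreal (min \<bar>z\<bar> s) = (\<integral>\<^sup>+u. indicator {..s} u * indicator {0<..\<bar>z\<bar>} u \<partial>lborel)" for z :: real
  proof -
    have "(\<integral>\<^sup>+u. indicator {..s} u * indicator {0<..\<bar>z\<bar>} u \<partial>lborel) = (\<integral>\<^sup>+u. indicator {0<..min \<bar>z\<bar> s} u \<partial>lborel)"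
      by (intro nn_integral_cong) (auto simp: indicator_def)
    then show ?thesis using s by simp
  qed
  have "(\<integral>\<^sup>+z. ennreal (min \<bar>z\<bar> s) \<partial>stable_levy_measure \<alpha> a b) =
    (\<integral>\<^sup>+u. indicator {..s} u * ennreal ((a + b) / \<alpha> * u powr (- \<alpha>)) * indicator {0<..} u \<partial>lborel)"
    unfolding eq using \<alpha> ab by (intro stable_layer_cake) auto
  also have "\<dots> = (\<integral>\<^sup>+u. ennreal ((a + b) / \<alpha> * u powr (- \<alpha>)) * indicator {0..s} u \<partial>lborel)"
  proof (rule nn_integral_cong_AE)
    show "AE u in lborel. indicator {..s} u * ennreal ((a + b) / \<alpha> * u powr (- \<alpha>)) * indicator {0<..} u =
      ennreal ((a + b) / \<alpha> * u powr (- \<alpha>)) * indicator {0..s} u"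
      using AE_lborel_singleton[of 0] by eventually_elim (auto simp: indicator_def)
  qed
  also have "\<dots> = ennreal ((a + b) / \<alpha> * (s powr (- \<alpha> + 1) / (- \<alpha> + 1)))"
  proof (rule nn_integral_has_integral_lebesgue')
    show "((\<lambda>u. (a + b) / \<alpha> * u powr (- \<alpha>)) has_integral (a + b) / \<alpha> * (s powr (- \<alpha> + 1) / (- \<alpha> + 1))) {0..s}"
      using \<alpha> s by (intro has_integral_mult_right has_integral_powr_from_0) auto
  qed (use \<alpha> ab in auto)
  finally show ?thesis using \<alpha> by (simp add: mult.commute)
qed

text \<open>The number 2 is the bound on |1 - iexp y|: the integrand dominates |1 - iexp (x z)|, so
  the value bounds the characteristic exponent.\<close>

lemma nn_integral_stable_min_scaled:
  assumes \<alpha>: "0 < \<alpha>" "\<alpha> < 1" and ab: "0 \<le> a" "0 \<le> b"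
  shows "(\<integral>\<^sup>+z. ennreal (min \<bar>x * z\<bar> 2) \<partial>stable_levy_measure \<alpha> a b) =
    ennreal ((a + b) / (\<alpha> * (1 - \<alpha>)) * 2 powr (1 - \<alpha>) * \<bar>x\<bar> powr \<alpha>)"
proof (cases "x = 0")
  case False
  have "min \<bar>x * z\<bar> 2 = \<bar>x\<bar> * min \<bar>z\<bar> (2 / \<bar>x\<bar>)" for z
    using False by (auto simp: min_def abs_mult field_simps)
  then have "(\<integral>\<^sup>+z. ennreal (min \<bar>x * z\<bar> 2) \<partial>stable_levy_measure \<alpha> a b) =
     (\<integral>\<^sup>+z. ennreal \<bar>x\<bar> * ennreal (min \<bar>z\<bar> (2 / \<bar>x\<bar>)) \<partial>stable_levy_measure \<alpha> a b)"
    by (simp add: ennreal_mult)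
  also have "\<dots> = ennreal \<bar>x\<bar> * ennreal ((a + b) / (\<alpha> * (1 - \<alpha>)) * (2 / \<bar>x\<bar>) powr (1 - \<alpha>))"
    by (subst nn_integral_cmult) (use nn_integral_stable_min[OF \<alpha> ab] in auto)
  also have "\<dots> = ennreal (\<bar>x\<bar> * ((a + b) / (\<alpha> * (1 - \<alpha>)) * (2 / \<bar>x\<bar>) powr (1 - \<alpha>)))"
    using \<alpha> ab by (subst ennreal_mult) auto
  also have "\<bar>x\<bar> * ((a + b) / (\<alpha> * (1 - \<alpha>)) * (2 / \<bar>x\<bar>) powr (1 - \<alpha>)) = (a + b) / (\<alpha> * (1 - \<alpha>)) * 2 powr (1 - \<alpha>) * \<bar>x\<bar> powr \<alpha>"
    using False by (simp add: powr_divide powr_diff) (simp add: algebra_simps)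
  finally show ?thesis .
qed simp

text \<open>The substitution t = l u^p leads to the Euler integral of Gamma (1 - \<alpha> / p),
  which converges because \<alpha> < p.\<close>

lemma powr_times_exp_integral:
  fixes p \<alpha> l :: real
  assumes \<alpha>: "0 < \<alpha>" "\<alpha> < p" and l: "0 < l"
  shows "(\<integral>\<^sup>+u. ennreal (l * p * u powr (p - 1) * exp (- (l * u powr p)) * u powr (- \<alpha>)) * indicator {0<..} u \<partial>lborel) =
    ennreal (l powr (\<alpha> / p) * Gamma (1 - \<alpha> / p))"
proof -
  have p: "0 < p" "0 < 1 - \<alpha> / p" using \<alpha> by auto
  define g where "g u = l * u powr p" for u
  define f where "f t = t powr ((1 - \<alpha> / p) - 1) / exp t" for t :: real
  have img: "g ` {0<..} = {0<..}"
  proof (intro equalityI subsetI)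
    fix t :: real assume "t \<in> {0<..}"
    then have "t = g ((t / l) powr (1 / p))" "(t / l) powr (1 / p) \<in> {0<..}"
      using l p by (auto simp: g_def powr_powr)
    then show "t \<in> g ` {0<..}" by blast
  qed (use l in \<open>auto simp: g_def\<close>)
  have "(f has_integral Gamma (1 - \<alpha> / p)) {0..}"
    unfolding f_def by (rule Gamma_integral_real[OF p(2)])
  then have fI: "(f has_integral Gamma (1 - \<alpha> / p)) {0<..}"
    by (rule has_integral_spike_set_eq[THEN iffD1, rotated -1]) (auto intro: negligible_subset[of "{0}"])
  then have "f absolutely_integrable_on {0<..}"
    by (intro nonnegative_absolutely_integrable_1) (auto simp: f_def has_integral_iff)
  then have "f absolutely_integrable_on (g ` {0<..}) \<and> integral (g ` {0<..}) f = Gamma (1 - \<alpha> / p)"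
    using fI unfolding img by (auto simp: has_integral_iff)
  moreover have "(\<lambda>x. \<bar>l * p * x powr (p - 1)\<bar> * f (g x)) absolutely_integrable_on {0<..} \<and>
     integral {0<..} (\<lambda>x. \<bar>l * p * x powr (p - 1)\<bar> * f (g x)) = Gamma (1 - \<alpha> / p) \<longleftrightarrow>
     f absolutely_integrable_on (g ` {0<..}) \<and> integral (g ` {0<..}) f = Gamma (1 - \<alpha> / p)"
  proof (rule has_absolute_integral_change_of_variables_1')
    show "(g has_real_derivative l * p * x powr (p - 1)) (at x within {0<..})" if "x \<in> {0<..}" for x
      using that unfolding g_def by (auto intro!: derivative_eq_intros)
    show "inj_on g {0<..}"
      by (rule inj_on_inverseI[where g="\<lambda>t. (t / l) powr (1 / p)"]) (use l p in \<open>auto simp: g_def powr_powr\<close>)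
  qed auto
  ultimately have "(\<lambda>x. \<bar>l * p * x powr (p - 1)\<bar> * f (g x)) absolutely_integrable_on {0<..} \<and>
     integral {0<..} (\<lambda>x. \<bar>l * p * x powr (p - 1)\<bar> * f (g x)) = Gamma (1 - \<alpha> / p)"
    by blast
  then have "((\<lambda>x. \<bar>l * p * x powr (p - 1)\<bar> * f (g x)) has_integral Gamma (1 - \<alpha> / p)) {0<..}"
    by (auto simp: has_integral_iff dest: set_lebesgue_integral_eq_integral)
  then have "((\<lambda>x. l powr (\<alpha> / p) * (\<bar>l * p * x powr (p - 1)\<bar> * f (g x))) has_integral l powr (\<alpha> / p) * Gamma (1 - \<alpha> / p)) {0<..}"
    by (rule has_integral_mult_right)
  then have "((\<lambda>u. l * p * u powr (p - 1) * exp (- (l * u powr p)) * u powr (- \<alpha>)) has_integral l powr (\<alpha> / p) * Gamma (1 - \<alpha> / p)) {0<..}"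
  proof (rule has_integral_eq[rotated])
    fix x :: real assume "x \<in> {0<..}"
    then have x: "0 < x" by simp
    have "f (g x) = l powr (- (\<alpha> / p)) * x powr (- \<alpha>) * exp (- (l * x powr p))"
      using x l p by (simp add: f_def g_def powr_mult powr_powr exp_minus inverse_eq_divide)
    then show "l powr (\<alpha> / p) * (\<bar>l * p * x powr (p - 1)\<bar> * f (g x)) =
       l * p * x powr (p - 1) * exp (- (l * x powr p)) * x powr (- \<alpha>)"
      using l p x by (simp add: powr_minus field_simps)
  qed
  then show ?thesis
    by (rule nn_integral_has_integral_lebesgue'[rotated]) (use l p in auto)
qed

text \<open>For p < 1 the integrand is unbounded at 0, so the fundamental theorem is applied with
  continuity on the closed interval and derivatives only in its interior.\<close>

lemma one_minus_exp_powr_integral: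
  fixes p l z :: real
  assumes p: "0 < p" and l: "0 < l" and z: "0 \<le> z"
  shows "(\<integral>\<^sup>+u. ennreal (l * p * u powr (p - 1) * exp (- (l * u powr p))) * indicator {0<..z} u \<partial>lborel) =
     ennreal (1 - exp (- (l * z powr p)))"
proof -
  have "((\<lambda>u. l * p * u powr (p - 1) * exp (- (l * u powr p))) has_integral
     (- exp (- (l * z powr p))) - (- exp (- (l * 0 powr p)))) {0..z}"
  proof (rule fundamental_theorem_of_calculus_interior[OF z])
    show "continuous_on {0..z} (\<lambda>u. - exp (- (l * u powr p)))"
      using p by (intro continuous_intros continuous_on_powr') auto
    fix x assume "x \<in> {0<..<z}"
    then show "((\<lambda>u. - exp (- (l * u powr p))) has_vector_derivative l * p * x powr (p - 1) * exp (- (l * x powr p))) (at x)"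
      unfolding has_real_derivative_iff_has_vector_derivative[symmetric]
      by (auto intro!: derivative_eq_intros)
  qed
  then have "((\<lambda>u. l * p * u powr (p - 1) * exp (- (l * u powr p))) has_integral (1 - exp (- (l * z powr p)))) {0..z}"
    using p by simp
  then have "((\<lambda>u. l * p * u powr (p - 1) * exp (- (l * u powr p))) has_integral (1 - exp (- (l * z powr p)))) {0<..z}"
    by (rule has_integral_spike_set_eq[THEN iffD1, rotated -1]) (auto intro: negligible_subset[of "{0}"])
  then show ?thesis
    by (rule nn_integral_has_integral_lebesgue'[rotated]) (use l p in auto)
qed

text \<open>Layer cake for the derivative of 1 - exp (- l u^p). The value is the exponent \<kappa>
  l^\<beta> of the Tauberian theorem, with \<beta> = \<alpha> / p.\<close>

lemma nn_integral_stable_one_minus_exp: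
  assumes \<alpha>: "0 < \<alpha>" "\<alpha> < p" and l: "0 < l" and ab: "0 \<le> a" "0 \<le> b"
  shows "(\<integral>\<^sup>+z. ennreal (1 - exp (- (l * \<bar>z\<bar> powr p))) \<partial>stable_levy_measure \<alpha> a b) =
    ennreal ((a + b) / \<alpha> * Gamma (1 - \<alpha> / p) * l powr (\<alpha> / p))"
proof -
  let ?G = "\<lambda>u. ennreal (l * p * u powr (p - 1) * exp (- (l * u powr p)))"
  have p: "0 < p" using \<alpha> by simp
  have "(\<integral>\<^sup>+z. ennreal (1 - exp (- (l * \<bar>z\<bar> powr p))) \<partial>stable_levy_measure \<alpha> a b) =
    (\<integral>\<^sup>+u. ?G u * ennreal ((a + b) / \<alpha> * u powr (- \<alpha>)) * indicator {0<..} u \<partial>lborel)"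
    using stable_layer_cake[of ?G \<alpha> a b] \<alpha> ab by (simp add: one_minus_exp_powr_integral[OF p l])
  also have "\<dots> = (\<integral>\<^sup>+u. ennreal ((a + b) / \<alpha>) * (ennreal (l * p * u powr (p - 1) * exp (- (l * u powr p)) * u powr (- \<alpha>)) * indicator {0<..} u) \<partial>lborel)"
  proof (rule nn_integral_cong)
    fix u
    have "?G u * ennreal ((a + b) / \<alpha> * u powr (- \<alpha>)) = ennreal ((a + b) / \<alpha>) * ennreal (l * p * u powr (p - 1) * exp (- (l * u powr p)) * u powr (- \<alpha>))"
      using l p \<alpha> ab by (subst (1 2) ennreal_mult[symmetric]) (auto simp: mult_ac)
    then show "?G u * ennreal ((a + b) / \<alpha> * u powr (- \<alpha>)) * indicator {0<..} u =
      ennreal ((a + b) / \<alpha>) * (ennreal (l * p * u powr (p - 1) * exp (- (l * u powr p)) * u powr (- \<alpha>)) * indicator {0<..} u)"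
      by (simp add: mult.assoc)
  qed
  also have "\<dots> = ennreal ((a + b) / \<alpha>) * ennreal (l powr (\<alpha> / p) * Gamma (1 - \<alpha> / p))"
    by (subst nn_integral_cmult) (use powr_times_exp_integral[OF \<alpha> l] in auto)
  also have "\<dots> = ennreal ((a + b) / \<alpha> * (l powr (\<alpha> / p) * Gamma (1 - \<alpha> / p)))"
    using \<alpha> ab p by (subst ennreal_mult) (auto intro!: mult_nonneg_nonneg Gamma_real_nonneg)
  finally show ?thesis by (simp add: mult_ac)
qed

section \<open>Small-time behaviour of the marginals\<close>

text \<open>The characteristic function at time t will be exp (- t \<Psi>), hence the sign. For
  \<alpha> < 1 the integrand is integrable without the usual compensator.\<close>

definition stable_exponent :: "real \<Rightarrow> real \<Rightarrow> real \<Rightarrow> real \<Rightarrow> complex" where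
  "stable_exponent \<alpha> a b u = (\<integral>z. 1 - iexp (u * z) \<partial>stable_levy_measure \<alpha> a b)"

lemma integrable_stable_one_minus_iexp:
  assumes \<alpha>: "0 < \<alpha>" "\<alpha> < 1" and ab: "0 \<le> a" "0 \<le> b"
  shows "integrable (stable_levy_measure \<alpha> a b) (\<lambda>z. 1 - iexp (u * z))"
proof (rule Bochner_Integration.integrable_bound)
  show "integrable (stable_levy_measure \<alpha> a b) (\<lambda>z. min \<bar>u * z\<bar> 2)"
    by (rule integrableI_nonneg) (use nn_integral_stable_min_scaled[OF \<alpha> ab, of u] in auto)
  show "AE z in stable_levy_measure \<alpha> a b. norm (1 - iexp (u * z)) \<le> norm (min \<bar>u * z\<bar> 2)"
    using norm_one_minus_iexp[of "u * z" for z] by (intro AE_I2) (simp add: abs_of_nonneg)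
qed measurable

text \<open>Mean value inequality on the half-plane of nonpositive real part, where the derivative
  of exp has modulus at most 1.\<close>

lemma cmod_one_minus_exp_le:
  assumes "0 \<le> Re w"
  shows "cmod (1 - exp (- w)) \<le> cmod w"
proof -
  have "cmod (exp 0 - exp (- w)) \<le> 1 * cmod (0 - (- w))"
  proof (rule field_differentiable_bound[where S="{z. Re z \<le> 0}" and f'=exp])
    show "convex {z. Re z \<le> 0}" by (rule convex_halfspace_Re_le)
    show "(exp has_field_derivative exp z) (at z within {z. Re z \<le> 0})" for z
      using DERIV_exp by (rule has_field_derivative_at_within)
  qed (use assms in auto)
  then show ?thesis by simp
qed

text \<open>Near 0 the kernel is bounded; beyond 1 it is at most 2 / x^2, and x^(\<alpha> - 2) is
  integrable there because \<alpha> < 1.\<close>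

lemma integrable_powr_cos_kernel_1:
  assumes \<alpha>: "0 < \<alpha>" "\<alpha> < 1"
  shows "integrable lborel (\<lambda>x. \<bar>x\<bar> powr \<alpha> * cos_kernel 1 x)"
proof (rule integrableI_nonneg)
  let ?f = "\<lambda>x. ennreal (\<bar>x\<bar> powr \<alpha> * cos_kernel 1 x)"
  have even: "cos_kernel 1 (- x) = cos_kernel 1 x" for x by (simp add: cos_kernel_def)
  have "(\<integral>\<^sup>+x. ?f x \<partial>lborel) = (\<integral>\<^sup>+x. (?f x + ?f (- x)) * indicator {0<..} x \<partial>lborel)"
    by (rule nn_integral_half_line) measurable
  \<comment> \<open>The constants 5 and 4 are twice the kernel bounds 5 / 2 and 2; the doubling
    comes from the two half-lines.\<close>
  also have "\<dots> \<le> (\<integral>\<^sup>+x. 5 * indicator {0..1} x + 4 * (ennreal (x powr (\<alpha> - 2)) * indicator {1..} x) \<partial>lborel)"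
  proof (rule nn_integral_mono)
    fix x :: real
    have k0: "cos_kernel 1 x \<le> 5 / 2"
    proof -
      have "inverse (1 + x\<^sup>2) \<le> 1" by (rule inverse_le_1_iff[THEN iffD2]) simp
      then show ?thesis using cos_kernel_bound[of x] by linarith
    qed
    show "(?f x + ?f (- x)) * indicator {0<..} x \<le> 5 * indicator {0..1} x + 4 * (ennreal (x powr (\<alpha> - 2)) * indicator {1..} x)"
    proof (cases "0 < x")
      case True
      show ?thesis
      proof (cases "x < 1")
        case x: True
        have "x powr \<alpha> \<le> 1" using True x \<alpha> powr_le1[of \<alpha> x] by simp
        then have "x powr \<alpha> * cos_kernel 1 x \<le> 1 * (5 / 2)" using k0 by (intro mult_mono) auto
        then have "ennreal (x powr \<alpha> * cos_kernel 1 x + x powr \<alpha> * cos_kernel 1 x) \<le> ennreal 5"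
          by (intro ennreal_leI) linarith
        then have "?f x + ?f x \<le> ennreal 5" using True by (subst ennreal_plus[symmetric]) auto
        then show ?thesis using True x by (simp add: even)
      next
        case False
        have "cos_kernel 1 x \<le> 2 * x powr (- 2)"
          using False True cos_ge_minus_one[of x]
          by (simp add: cos_kernel_def powr_minus powr_numeral divide_inverse mult_right_mono)
        then have "x powr \<alpha> * cos_kernel 1 x \<le> x powr \<alpha> * (2 * x powr (- 2))" by (intro mult_left_mono) auto
        also have "\<dots> = 2 * x powr (\<alpha> - 2)" using True by (simp add: powr_diff powr_minus divide_inverse)
        finally have "ennreal (x powr \<alpha> * cos_kernel 1 x + x powr \<alpha> * cos_kernel 1 x) \<le> ennreal (4 * x powr (\<alpha> - 2))"
          by (intro ennreal_leI) linarith
        then have "?f x + ?f x \<le> ennreal (4 * x powr (\<alpha> - 2))"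
          using True by (subst ennreal_plus[symmetric]) auto
        then show ?thesis using True False by (simp add: even ennreal_mult add_increasing)
      qed
    qed simp
  qed
  also have "\<dots> = 5 + 4 * (\<integral>\<^sup>+x. ennreal (x powr (\<alpha> - 2)) * indicator {1..} x \<partial>lborel)"
    by (subst nn_integral_add) (auto simp: nn_integral_cmult)
  also have "\<dots> < \<infinity>"
    using nn_integral_powr_tail[of "\<alpha> - 2" 1] \<alpha> by (simp add: ennreal_mult_less_top)
  finally show "(\<integral>\<^sup>+x. ?f x \<partial>lborel) < \<infinity>" .
qed auto

definition powr_cos_kernel_mass :: "real \<Rightarrow> real" where
  "powr_cos_kernel_mass \<alpha> = (\<integral>x. \<bar>x\<bar> powr \<alpha> * cos_kernel 1 x \<partial>lborel)"

text \<open>Scaling by s. The power s^(1 - \<alpha>) is the one in the Levy integral of min |z| s,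
  so a single integrability statement over s will cover both.\<close>

lemma has_integral_powr_cos_kernel:
  assumes \<alpha>: "0 < \<alpha>" "\<alpha> < 1" and s: "0 \<le> s"
  shows "has_bochner_integral lborel (\<lambda>x. \<bar>x\<bar> powr \<alpha> * cos_kernel s x) (powr_cos_kernel_mass \<alpha> * s powr (1 - \<alpha>))"
proof (cases "s = 0")
  case False
  then have s: "0 < s" using s by simp
  have "has_bochner_integral lborel (\<lambda>x. \<bar>x\<bar> powr \<alpha> * cos_kernel 1 x) (powr_cos_kernel_mass \<alpha>)"
    using integrable_powr_cos_kernel_1[OF \<alpha>] by (simp add: has_bochner_integral_iff powr_cos_kernel_mass_def)
  from lborel_has_bochner_integral_real_affine_iff[OF False, THEN iffD1, OF this, of 0]
  have "has_bochner_integral lborel (\<lambda>x. \<bar>s * x\<bar> powr \<alpha> * cos_kernel 1 (s * x)) (powr_cos_kernel_mass \<alpha> / s)"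
    using s by (simp add: divide_inverse mult.commute)
  then have "has_bochner_integral lborel (\<lambda>x. s powr (2 - \<alpha>) * (\<bar>s * x\<bar> powr \<alpha> * cos_kernel 1 (s * x))) (s powr (2 - \<alpha>) * (powr_cos_kernel_mass \<alpha> / s))"
    by (rule has_bochner_integral_mult_right)
  moreover have "s powr (2 - \<alpha>) * (\<bar>s * x\<bar> powr \<alpha> * cos_kernel 1 (s * x)) = \<bar>x\<bar> powr \<alpha> * cos_kernel s x" for x
    using s by (simp add: cos_kernel_def power_mult_distrib abs_mult powr_mult powr_diff)
  moreover have "s powr (2 - \<alpha>) / s = s powr (1 - \<alpha>)"
    using s powr_diff[of s "2 - \<alpha>" 1] by simp
  then have "s powr (2 - \<alpha>) * (powr_cos_kernel_mass \<alpha> / s) = powr_cos_kernel_mass \<alpha> * s powr (1 - \<alpha>)"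
    by (metis mult.commute times_divide_eq_right)
  ultimately show ?thesis by simp
qed (simp add: cos_kernel_def[abs_def] has_bochner_integral_zero)

text \<open>The small-time analysis sees the process only through its one-dimensional laws at
  positive times. Drift and Gaussian part are already absent from \<open>char_mu\<close>.\<close>

locale stable_marginals =
  fixes \<alpha> a b :: real and \<mu> :: "real \<Rightarrow> real measure"
  assumes alpha: "0 < \<alpha>" "\<alpha> < 1" and coeffs: "0 \<le> a" "0 \<le> b" "0 < a + b"
    and prob: "0 < t \<Longrightarrow> real_distribution (\<mu> t)"
    and char_mu: "0 < t \<Longrightarrow> char (\<mu> t) u = exp (- (t * stable_exponent \<alpha> a b u))"
begin

abbreviation \<nu> where "\<nu> \<equiv> stable_levy_measure \<alpha> a b"
abbreviation \<Psi> where "\<Psi> \<equiv> stable_exponent \<alpha> a b"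

sublocale nu: sigma_finite_measure \<nu>
  by (rule sigma_finite_stable_levy_measure)

definition exponent_bound :: real where
  "exponent_bound = (a + b) / (\<alpha> * (1 - \<alpha>)) * 2 powr (1 - \<alpha>)"

lemma exponent_bound_nonneg: "0 \<le> exponent_bound"
  using alpha coeffs by (simp add: exponent_bound_def)

lemma has_integral_min_scaled:
  "has_bochner_integral \<nu> (\<lambda>z. min \<bar>x * z\<bar> 2) (exponent_bound * \<bar>x\<bar> powr \<alpha>)"
  using nn_integral_stable_min_scaled[OF alpha coeffs(1,2), of x] exponent_bound_nonneg
  unfolding exponent_bound_def[symmetric] by (intro has_bochner_integral_nn_integral) auto

lemma integrable_one_minus_iexp: "integrable \<nu> (\<lambda>z. 1 - iexp (x * z))"
  by (rule integrable_stable_one_minus_iexp[OF alpha coeffs(1,2)])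

lemma norm_exponent_le: "cmod (\<Psi> x) \<le> exponent_bound * \<bar>x\<bar> powr \<alpha>"
proof -
  have "cmod (\<Psi> x) \<le> (\<integral>z. min \<bar>x * z\<bar> 2 \<partial>\<nu>)"
    unfolding stable_exponent_def
  proof (rule Bochner_Integration.integral_norm_bound_integral)
    show "integrable \<nu> (\<lambda>z. min \<bar>x * z\<bar> 2)"
      using has_integral_min_scaled by (simp add: has_bochner_integral_iff)
  qed (rule integrable_one_minus_iexp, rule norm_one_minus_iexp)
  then show ?thesis using has_integral_min_scaled[of x] by (simp add: has_bochner_integral_iff)
qed

lemma Re_exponent_nonneg: "0 \<le> Re (\<Psi> x)"
  unfolding stable_exponent_def integral_Re[OF integrable_one_minus_iexp, symmetric]
  by (rule integral_nonneg_AE) (auto simp: Re_exp)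

lemma exponent_measurable[measurable]: "\<Psi> \<in> borel_measurable borel"
  unfolding stable_exponent_def[abs_def] by measurable

lemma bump_nu:
  assumes s: "0 \<le> s"
  shows "integrable \<nu> (\<lambda>z. min \<bar>z - y\<bar> s - min \<bar>y\<bar> s)" (is ?A)
    and "(\<integral>z. min \<bar>z - y\<bar> s - min \<bar>y\<bar> s \<partial>\<nu>) =
      (\<integral>x. Re (iexp (- (x * y)) * \<Psi> x) * cos_kernel s x \<partial>lborel) / cos_kernel_mass" (is ?B)
proof -
  have "(\<integral>\<^sup>+x. (\<integral>\<^sup>+z. ennreal (min \<bar>x * z\<bar> 2) \<partial>\<nu>) * ennreal (cos_kernel s x) \<partial>lborel) =
      (\<integral>\<^sup>+x. ennreal (exponent_bound * (\<bar>x\<bar> powr \<alpha> * cos_kernel s x)) \<partial>lborel)"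
    unfolding nn_integral_stable_min_scaled[OF alpha coeffs(1,2)] exponent_bound_def[symmetric]
    using exponent_bound_nonneg by (intro nn_integral_cong) (simp add: ennreal_mult mult.assoc)
  also have "\<dots> < \<infinity>"
  proof -
    have "integrable lborel (\<lambda>x. exponent_bound * (\<bar>x\<bar> powr \<alpha> * cos_kernel s x))"
      using has_integral_powr_cos_kernel[OF alpha s] by (simp add: has_bochner_integral_iff)
    then show ?thesis
      by (subst nn_integral_eq_integral) (use exponent_bound_nonneg in auto)
  qed
  finally have fin: "(\<integral>\<^sup>+x. (\<integral>\<^sup>+z. ennreal (min \<bar>x * z\<bar> 2) \<partial>\<nu>) * ennreal (cos_kernel s x) \<partial>lborel) < \<infinity>" .
  from integral_bump[OF nu.sigma_finite_measure_axioms _ s fin, of y] show ?A ?B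
    by (auto simp: stable_exponent_def)
qed

lemma bump_mu:
  assumes s: "0 \<le> s" and t: "0 < t"
  shows "integrable (\<mu> t) (\<lambda>z. min \<bar>z - y\<bar> s - min \<bar>y\<bar> s)" (is ?A)
    and "(\<integral>z. min \<bar>z - y\<bar> s - min \<bar>y\<bar> s \<partial>\<mu> t) =
      (\<integral>x. Re (iexp (- (x * y)) * (1 - exp (- (t * \<Psi> x)))) * cos_kernel s x \<partial>lborel) / cos_kernel_mass" (is ?B)
proof -
  interpret real_distribution "\<mu> t" by (rule prob[OF t])
  have 1: "(\<integral>\<^sup>+z. ennreal (min \<bar>x * z\<bar> 2) \<partial>\<mu> t) \<le> 2" for x
  proof -
    have "(\<integral>\<^sup>+z. ennreal (min \<bar>x * z\<bar> 2) \<partial>\<mu> t) \<le> (\<integral>\<^sup>+z. ennreal 2 \<partial>\<mu> t)"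
      by (intro nn_integral_mono ennreal_leI) auto
    then show ?thesis using emeasure_space_1 by simp
  qed
  have "(\<integral>\<^sup>+x. (\<integral>\<^sup>+z. ennreal (min \<bar>x * z\<bar> 2) \<partial>\<mu> t) * ennreal (cos_kernel s x) \<partial>lborel) \<le>
      (\<integral>\<^sup>+x. 2 * ennreal (cos_kernel s x) \<partial>lborel)"
    using 1 by (intro nn_integral_mono mult_right_mono) auto
  also have "\<dots> = 2 * ennreal (cos_kernel_mass * \<bar>s\<bar>)"
    using has_integral_cos_kernel[of s]
    by (subst nn_integral_cmult) (auto simp: nn_integral_eq_integral has_bochner_integral_iff)
  also have "\<dots> < \<infinity>" by (simp add: ennreal_mult_less_top)
  finally have fin: "(\<integral>\<^sup>+x. (\<integral>\<^sup>+z. ennreal (min \<bar>x * z\<bar> 2) \<partial>\<mu> t) * ennreal (cos_kernel s x) \<partial>lborel) < \<infinity>" .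
  have "(\<integral>z. 1 - iexp (x * z) \<partial>\<mu> t) = 1 - exp (- (t * \<Psi> x))" for x
    using prob_space integrable_iexp[of "\<lambda>z. x * z"] unfolding char_mu[OF t, symmetric] char_def
    by (subst Bochner_Integration.integral_diff) auto
  with integral_bump[OF sigma_finite_measure_axioms _ s fin, of y] show ?A ?B
    by auto
qed

text \<open>Since Re \<Psi> is nonnegative, |1 - exp (- t \<Psi>)| is at most t |\<Psi>|; dividing
  by t leaves a majorant that depends neither on t nor on y.\<close>

lemma norm_bump_integrand:
  assumes t: "0 < t"
  shows "\<bar>Re (iexp (- (x * y)) * (1 - exp (- (t * \<Psi> x)))) * cos_kernel s x / t\<bar> \<le> exponent_bound * (\<bar>x\<bar> powr \<alpha> * cos_kernel s x)"
proof -
  have "\<bar>Re (iexp (- (x * y)) * (1 - exp (- (t * \<Psi> x))))\<bar> \<le> cmod (iexp (- (x * y)) * (1 - exp (- (t * \<Psi> x))))"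
    by (rule abs_Re_le_cmod)
  also have "\<dots> = cmod (1 - exp (- (t * \<Psi> x)))" by (simp add: norm_mult)
  also have "\<dots> \<le> t * cmod (\<Psi> x)"
    using cmod_one_minus_exp_le[of "t * \<Psi> x"] Re_exponent_nonneg[of x] t by (simp add: norm_mult)
  also have "\<dots> \<le> t * (exponent_bound * \<bar>x\<bar> powr \<alpha>)"
    using t norm_exponent_le by (intro mult_left_mono) auto
  finally have "\<bar>Re (iexp (- (x * y)) * (1 - exp (- (t * \<Psi> x))))\<bar> / t \<le> exponent_bound * \<bar>x\<bar> powr \<alpha>"
    using t by (simp add: field_simps)
  then have "\<bar>Re (iexp (- (x * y)) * (1 - exp (- (t * \<Psi> x))))\<bar> / t * cos_kernel s x \<le> exponent_bound * \<bar>x\<bar> powr \<alpha> * cos_kernel s x"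
    by (rule mult_right_mono) simp
  then show ?thesis using t by (simp add: abs_mult mult.assoc)
qed

lemma integrable_bump_bound:
  "0 \<le> s \<Longrightarrow> integrable lborel (\<lambda>x. exponent_bound * (\<bar>x\<bar> powr \<alpha> * cos_kernel s x))"
  using has_integral_powr_cos_kernel[OF alpha, of s] by (simp add: has_bochner_integral_iff)

text \<open>Dominated convergence on the Fourier side: (1 - exp (- h \<Psi>)) / h tends to \<Psi>,
  the derivative of 1 - exp (- h \<Psi>) at h = 0. This takes the place of vague convergence of the
  laws divided by time to \<nu>.\<close>

lemma bump_limit:
  assumes s: "0 \<le> s" and t: "\<And>n. 0 < t n" "t \<longlonglongrightarrow> 0"
  shows "(\<lambda>n. (\<integral>z. min \<bar>z - y\<bar> s - min \<bar>y\<bar> s \<partial>\<mu> (t n)) / t n) \<longlonglongrightarrow> (\<integral>z. min \<bar>z - y\<bar> s - min \<bar>y\<bar> s \<partial>\<nu>)"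
proof -
  have "(\<lambda>n. \<integral>x. Re (iexp (- (x * y)) * (1 - exp (- (t n * \<Psi> x)))) * cos_kernel s x / t n \<partial>lborel) \<longlonglongrightarrow>
      (\<integral>x. Re (iexp (- (x * y)) * \<Psi> x) * cos_kernel s x \<partial>lborel)"
  proof (rule integral_dominated_convergence)
    show "integrable lborel (\<lambda>x. exponent_bound * (\<bar>x\<bar> powr \<alpha> * cos_kernel s x))"
      by (rule integrable_bump_bound[OF s])
    show "AE x in lborel. (\<lambda>n. Re (iexp (- (x * y)) * (1 - exp (- (t n * \<Psi> x)))) * cos_kernel s x / t n) \<longlonglongrightarrow>
        Re (iexp (- (x * y)) * \<Psi> x) * cos_kernel s x"
    proof (rule AE_I2)
      fix x
      have "((\<lambda>h. exp (- (h * \<Psi> x))) has_field_derivative - \<Psi> x) (at 0)"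
        by (rule derivative_eq_intros refl | simp)+
      then have "((\<lambda>h. (exp (- (h * \<Psi> x)) - 1) / h) \<longlongrightarrow> - \<Psi> x) (at 0)"
        by (simp add: DERIV_def)
      moreover have "filterlim (\<lambda>n. complex_of_real (t n)) (at 0) sequentially"
        using t by (auto simp: filterlim_at intro!: always_eventually tendsto_eq_intros) (metis less_irrefl)
      ultimately have "(\<lambda>n. (exp (- (t n * \<Psi> x)) - 1) / t n) \<longlonglongrightarrow> - \<Psi> x"
        by (rule filterlim_compose)
      then have "(\<lambda>n. Re (iexp (- (x * y)) * (- ((exp (- (t n * \<Psi> x)) - 1) / t n))) * cos_kernel s x) \<longlonglongrightarrow> Re (iexp (- (x * y)) * (- (- \<Psi> x))) * cos_kernel s x"
        by (intro tendsto_intros)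
      moreover have "Re (iexp (- (x * y)) * (- ((exp (- (t n * \<Psi> x)) - 1) / t n))) * cos_kernel s x =
        Re (iexp (- (x * y)) * (1 - exp (- (t n * \<Psi> x)))) * cos_kernel s x / t n" for n
      proof -
        have "iexp (- (x * y)) * (- ((exp (- (t n * \<Psi> x)) - 1) / t n)) = iexp (- (x * y)) * (1 - exp (- (t n * \<Psi> x))) / t n"
          by (simp add: minus_divide_left)
        then show ?thesis by (simp only: Re_divide_of_real) simp
      qed
      ultimately show "(\<lambda>n. Re (iexp (- (x * y)) * (1 - exp (- (t n * \<Psi> x)))) * cos_kernel s x / t n) \<longlonglongrightarrow>
        Re (iexp (- (x * y)) * \<Psi> x) * cos_kernel s x" by simp
    qed
    show "AE x in lborel. norm (Re (iexp (- (x * y)) * (1 - exp (- (t n * \<Psi> x)))) * cos_kernel s x / t n) \<le> exponent_bound * (\<bar>x\<bar> powr \<alpha> * cos_kernel s x)" for n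
      using norm_bump_integrand[OF t(1)] by simp
  qed measurable
  then have "(\<lambda>n. (\<integral>x. Re (iexp (- (x * y)) * (1 - exp (- (t n * \<Psi> x)))) * cos_kernel s x / t n \<partial>lborel) / cos_kernel_mass) \<longlonglongrightarrow>
      (\<integral>x. Re (iexp (- (x * y)) * \<Psi> x) * cos_kernel s x \<partial>lborel) / cos_kernel_mass"
    using cos_kernel_mass_pos by (intro tendsto_intros) auto
  then show ?thesis
    unfolding bump_nu(2)[OF s] bump_mu(2)[OF s t(1)] by (simp add: mult.commute)
qed

text \<open>Integration of the uniform majorant at y = 0. A growth of s^(1 - \<alpha>), uniform in
  t, is what the later mixing over s can absorb.\<close>

lemma min_mu_bound:
  assumes s: "0 \<le> s" and t: "0 < t"
  shows "(\<integral>z. min \<bar>z\<bar> s \<partial>\<mu> t) / t \<le> exponent_bound * powr_cos_kernel_mass \<alpha> / cos_kernel_mass * s powr (1 - \<alpha>)"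
proof -
  have "(\<integral>x. Re (iexp (- (x * 0)) * (1 - exp (- (t * \<Psi> x)))) * cos_kernel s x / t \<partial>lborel) \<le>
    (\<integral>x. exponent_bound * (\<bar>x\<bar> powr \<alpha> * cos_kernel s x) \<partial>lborel)"
  proof (rule integral_mono)
    show "integrable lborel (\<lambda>x. Re (iexp (- (x * 0)) * (1 - exp (- (t * \<Psi> x)))) * cos_kernel s x / t)"
      by (rule Bochner_Integration.integrable_bound[OF integrable_bump_bound[OF s]])
       (use order_trans[OF norm_bump_integrand[OF t, of _ 0] abs_ge_self] in \<open>auto intro!: AE_I2\<close>)
    show "Re (iexp (- (x * 0)) * (1 - exp (- (t * \<Psi> x)))) * cos_kernel s x / t \<le> exponent_bound * (\<bar>x\<bar> powr \<alpha> * cos_kernel s x)" for x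
      using norm_bump_integrand[OF t, of x 0 s] by (rule order_trans[OF abs_ge_self])
  qed (rule integrable_bump_bound[OF s])
  also have "\<dots> = exponent_bound * (powr_cos_kernel_mass \<alpha> * s powr (1 - \<alpha>))"
    using has_integral_powr_cos_kernel[OF alpha s] by (simp add: has_bochner_integral_iff)
  finally have le: "(\<integral>x. Re (iexp (- (x * 0)) * (1 - exp (- (t * \<Psi> x)))) * cos_kernel s x / t \<partial>lborel) / cos_kernel_mass
    \<le> exponent_bound * (powr_cos_kernel_mass \<alpha> * s powr (1 - \<alpha>)) / cos_kernel_mass"
    using cos_kernel_mass_pos by (intro divide_right_mono) auto
  have "(\<integral>z. min \<bar>z\<bar> s \<partial>\<mu> t) = (\<integral>z. min \<bar>z - 0\<bar> s - min \<bar>0\<bar> s \<partial>\<mu> t)" using s by simp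
  also have "\<dots> / t = (\<integral>x. Re (iexp (- (x * 0)) * (1 - exp (- (t * \<Psi> x)))) * cos_kernel s x / t \<partial>lborel) / cos_kernel_mass"
    unfolding bump_mu(2)[OF s t] by (simp add: mult.commute)
  finally show ?thesis using le by (simp add: mult.assoc)
qed
end

section \<open>Polya's representation and small-time Laplace transforms\<close>

text \<open>Minus the second derivative of 1 - exp (- l s^p) on the positive half-line, nonnegative
  by concavity for p \<le> 1.\<close>

definition polya_density :: "real \<Rightarrow> real \<Rightarrow> real \<Rightarrow> real" where
  "polya_density p l s = l * p * s powr (p - 2) * (1 - p + l * p * s powr p) * exp (- (l * s powr p)) * indicator {0<..} s"

lemma polya_density_nonneg: "0 < p \<Longrightarrow> p \<le> 1 \<Longrightarrow> 0 < l \<Longrightarrow> 0 \<le> polya_density p l s"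
  by (simp add: polya_density_def)

lemma polya_density_measurable[measurable]: "polya_density p l \<in> borel_measurable borel"
  unfolding polya_density_def[abs_def] by measurable

lemma nn_integral_polya_density:
  assumes p: "0 < p" "p \<le> 1" and l: "0 < l" and u: "0 < u"
  shows "(\<integral>\<^sup>+s. ennreal (polya_density p l s) * indicator {u..} s \<partial>lborel) =
    ennreal (l * p * u powr (p - 1) * exp (- (l * u powr p)))"
proof -
  let ?h = "\<lambda>s. l * p * s powr (p - 1) * exp (- (l * s powr p))"
  have "(\<integral>\<^sup>+s. ennreal (polya_density p l s) * indicator {u..} s \<partial>lborel) = ennreal (0 - (- ?h u))"
  proof (rule nn_integral_FTC_atLeast)
    fix s assume "u \<le> s"
    then have s: "0 < s" using u by simp
    have "((\<lambda>s. - ?h s) has_real_derivative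
       - (l * p * ((p - 1) * s powr (p - 1 - 1)) * exp (- (l * s powr p))
         + exp (- (l * s powr p)) * (- (l * (p * s powr (p - 1)))) * (l * p * s powr (p - 1)))) (at s)"
      using s by (auto intro!: derivative_eq_intros)
    moreover have "s powr (p - 1) * s powr (p - 1) = s powr (p - 2) * s powr p"
      by (simp add: powr_add[symmetric])
    then have "- (l * p * ((p - 1) * s powr (p - 1 - 1)) * exp (- (l * s powr p))
         + exp (- (l * s powr p)) * (- (l * (p * s powr (p - 1)))) * (l * p * s powr (p - 1))) = polya_density p l s"
      using s by (simp add: polya_density_def algebra_simps)
    ultimately show "((\<lambda>s. - ?h s) has_real_derivative polya_density p l s) (at s)" by simp
  next
    have "((\<lambda>s. - (l * p * exp (- (l * s powr p)))) \<longlongrightarrow> 0) at_top"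
      using p l by real_asymp
    moreover have "\<forall>\<^sub>F s in at_top. - (l * p * exp (- (l * s powr p))) \<le> - ?h s"
      using eventually_ge_at_top[of 1]
    proof eventually_elim
      fix s :: real assume "1 \<le> s"
      then have "s powr (p - 1) \<le> 1" using p powr_mono[of "p - 1" 0 s] by simp
      then have "l * p * s powr (p - 1) * exp (- (l * s powr p)) \<le> l * p * 1 * exp (- (l * s powr p))"
        using p l by (intro mult_left_mono mult_right_mono) auto
      then show "- (l * p * exp (- (l * s powr p))) \<le> - ?h s" by simp
    qed
    moreover have "\<forall>\<^sub>F s in at_top. - ?h s \<le> 0" using p l by simp
    ultimately show "((\<lambda>s. - ?h s) \<longlongrightarrow> 0) at_top"
      by (rule real_tendsto_sandwich[OF _ _ _ tendsto_const, rotated 2])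
  qed (use p l in \<open>auto intro: polya_density_nonneg\<close>)
  then show ?thesis by simp
qed

text \<open>Write f z = 1 - exp (- l z^p). As f 0 = 0, f z is the integral of f' over u from 0 to z;
  as f' vanishes at infinity, f' u is the integral of - f'' over s from u on. Exchanging the
  integrals leaves the length min z s of the admissible u.\<close>

lemma polya_representation:
  assumes p: "0 < p" "p \<le> 1" and l: "0 < l" and z: "0 \<le> z"
  shows "ennreal (1 - exp (- (l * z powr p))) = (\<integral>\<^sup>+s. ennreal (polya_density p l s) * ennreal (min z s) \<partial>lborel)"
proof -
  have "(\<integral>\<^sup>+s. ennreal (polya_density p l s) * ennreal (min z s) \<partial>lborel) =
      (\<integral>\<^sup>+s. (\<integral>\<^sup>+u. ennreal (polya_density p l s) * indicator {0<..z} u * indicator {u..} s \<partial>lborel) \<partial>lborel)"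
  proof (rule nn_integral_cong)
    fix s :: real
    show "ennreal (polya_density p l s) * ennreal (min z s) =
      (\<integral>\<^sup>+u. ennreal (polya_density p l s) * indicator {0<..z} u * indicator {u..} s \<partial>lborel)"
    proof (cases "0 < s")
      case True
      have "(\<integral>\<^sup>+u. ennreal (polya_density p l s) * indicator {0<..z} u * indicator {u..} s \<partial>lborel) =
         (\<integral>\<^sup>+u. ennreal (polya_density p l s) * indicator {0<..min z s} u \<partial>lborel)"
        by (intro nn_integral_cong) (auto simp: indicator_def)
      also have "\<dots> = ennreal (polya_density p l s) * ennreal (min z s)"
        using True z by (subst nn_integral_cmult) auto
      finally show ?thesis by simp
    qed (simp add: polya_density_def)
  qed
  also have "\<dots> = (\<integral>\<^sup>+u. (\<integral>\<^sup>+s. ennreal (polya_density p l s) * indicator {0<..z} u * indicator {u..} s \<partial>lborel) \<partial>lborel)"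
    by (rule lborel_pair.Fubini'[symmetric]) (unfold indicator_def atLeast_iff, measurable)
  also have "\<dots> = (\<integral>\<^sup>+u. ennreal (l * p * u powr (p - 1) * exp (- (l * u powr p))) * indicator {0<..z} u \<partial>lborel)"
  proof (rule nn_integral_cong)
    fix u :: real
    have "(\<integral>\<^sup>+s. ennreal (polya_density p l s) * indicator {0<..z} u * indicator {u..} s \<partial>lborel) =
       (\<integral>\<^sup>+s. indicator {0<..z} u * (ennreal (polya_density p l s) * indicator {u..} s) \<partial>lborel)"
      by (intro nn_integral_cong) (simp add: mult_ac)
    also have "\<dots> = indicator {0<..z} u * (\<integral>\<^sup>+s. ennreal (polya_density p l s) * indicator {u..} s \<partial>lborel)"
      by (rule nn_integral_cmult) measurable
    also have "\<dots> = ennreal (l * p * u powr (p - 1) * exp (- (l * u powr p))) * indicator {0<..z} u"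
      using nn_integral_polya_density[OF p l, of u] by (auto simp: indicator_def)
    finally show "(\<integral>\<^sup>+s. ennreal (polya_density p l s) * indicator {0<..z} u * indicator {u..} s \<partial>lborel) =
       ennreal (l * p * u powr (p - 1) * exp (- (l * u powr p))) * indicator {0<..z} u" .
  qed
  finally show ?thesis using one_minus_exp_powr_integral[OF p(1) l z] by simp
qed

lemma nn_integral_polya:
  assumes N: "sigma_finite_measure N" and sets[measurable_cong, simp]: "sets N = sets borel"
    and p: "0 < p" "p \<le> 1" and l: "0 < l"
  shows "(\<integral>\<^sup>+z. ennreal (1 - exp (- (l * \<bar>z\<bar> powr p))) \<partial>N) =
    (\<integral>\<^sup>+s. ennreal (polya_density p l s) * (\<integral>\<^sup>+z. ennreal (min \<bar>z\<bar> s) \<partial>N) \<partial>lborel)"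
proof -
  interpret N: sigma_finite_measure N by fact
  interpret pair_sigma_finite N lborel by standard
  have "(\<integral>\<^sup>+z. ennreal (1 - exp (- (l * \<bar>z\<bar> powr p))) \<partial>N) =
    (\<integral>\<^sup>+z. (\<integral>\<^sup>+s. ennreal (polya_density p l s) * ennreal (min \<bar>z\<bar> s) \<partial>lborel) \<partial>N)"
    by (simp add: polya_representation[OF p l])
  also have "\<dots> = (\<integral>\<^sup>+s. (\<integral>\<^sup>+z. ennreal (polya_density p l s) * ennreal (min \<bar>z\<bar> s) \<partial>N) \<partial>lborel)"
    by (rule Fubini'[symmetric]) measurable
  also have "\<dots> = (\<integral>\<^sup>+s. ennreal (polya_density p l s) * (\<integral>\<^sup>+z. ennreal (min \<bar>z\<bar> s) \<partial>N) \<partial>lborel)"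
    by (intro nn_integral_cong nn_integral_cmult) measurable
  finally show ?thesis .
qed

context stable_marginals
begin

text \<open>The representation read backwards: mixing the \<nu>-integrals of min |z| s over s gives
  the \<nu>-integral of 1 - exp (- l |z|^p), already computed. This supplies both the limit and an
  integrable majorant for \<open>exp_limit\<close>.\<close>

lemma has_integral_polya_powr:
  assumes p: "\<alpha> < p" "p \<le> 1" and l: "0 < l"
  shows "has_bochner_integral lborel (\<lambda>s. polya_density p l s * ((a + b) / (\<alpha> * (1 - \<alpha>)) * s powr (1 - \<alpha>)))
    ((a + b) / \<alpha> * Gamma (1 - \<alpha> / p) * l powr (\<alpha> / p))"
proof (rule has_bochner_integral_nn_integral)
  have p0: "0 < p" using p alpha by simp
  show "AE s in lborel. 0 \<le> polya_density p l s * ((a + b) / (\<alpha> * (1 - \<alpha>)) * s powr (1 - \<alpha>))"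
    using polya_density_nonneg[OF p0 p(2) l] alpha coeffs by (intro AE_I2 mult_nonneg_nonneg) auto
  have "(\<integral>\<^sup>+s. ennreal (polya_density p l s * ((a + b) / (\<alpha> * (1 - \<alpha>)) * s powr (1 - \<alpha>))) \<partial>lborel) =
    (\<integral>\<^sup>+s. ennreal (polya_density p l s) * (\<integral>\<^sup>+z. ennreal (min \<bar>z\<bar> s) \<partial>\<nu>) \<partial>lborel)"
  proof (rule nn_integral_cong)
    fix s
    show "ennreal (polya_density p l s * ((a + b) / (\<alpha> * (1 - \<alpha>)) * s powr (1 - \<alpha>))) =
      ennreal (polya_density p l s) * (\<integral>\<^sup>+z. ennreal (min \<bar>z\<bar> s) \<partial>\<nu>)"
    proof (cases "0 < s")
      case True
      then show ?thesis
        using polya_density_nonneg[OF p0 p(2) l] nn_integral_stable_min[OF alpha coeffs(1,2), of s]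
        by (simp only: ennreal_mult' less_imp_le)
    qed (simp add: polya_density_def)
  qed
  also have "\<dots> = ennreal ((a + b) / \<alpha> * Gamma (1 - \<alpha> / p) * l powr (\<alpha> / p))"
    unfolding nn_integral_polya[OF nu.sigma_finite_measure_axioms sets_stable_levy_measure p0 p(2) l, symmetric]
    using nn_integral_stable_one_minus_exp[OF alpha(1) p(1) l coeffs(1,2)] .
  finally show "(\<integral>\<^sup>+s. ennreal (polya_density p l s * ((a + b) / (\<alpha> * (1 - \<alpha>)) * s powr (1 - \<alpha>))) \<partial>lborel) =
     ennreal ((a + b) / \<alpha> * Gamma (1 - \<alpha> / p) * l powr (\<alpha> / p))" .
  show "0 \<le> (a + b) / \<alpha> * Gamma (1 - \<alpha> / p) * l powr (\<alpha> / p)"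
    using alpha coeffs p by (intro mult_nonneg_nonneg Gamma_real_nonneg) auto
qed measurable

lemma integrable_min_mu:
  assumes "0 \<le> s" "0 < t"
  shows "integrable (\<mu> t) (\<lambda>z. min \<bar>z\<bar> s)"
  using bump_mu(1)[OF assms, of 0] assms by simp

lemma integral_exp_mu:
  assumes p: "\<alpha> < p" "p \<le> 1" and l: "0 < l" and t: "0 < t"
  shows "(\<integral>z. 1 - exp (- (l * \<bar>z\<bar> powr p)) \<partial>\<mu> t) = (\<integral>s. polya_density p l s * (\<integral>z. min \<bar>z\<bar> s \<partial>\<mu> t) \<partial>lborel)"
proof -
  interpret real_distribution "\<mu> t" by (rule prob[OF t])
  have p0: "0 < p" using p alpha by simp
  note nn = polya_density_nonneg[OF p0 p(2) l]
  have nn2: "0 \<le> polya_density p l s * (\<integral>z. min \<bar>z\<bar> s \<partial>\<mu> t)" for s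
  proof (cases "0 < s")
    case True then show ?thesis using nn by (intro mult_nonneg_nonneg integral_nonneg_AE) auto
  qed (simp add: polya_density_def)
  have "(\<integral>\<^sup>+z. ennreal (1 - exp (- (l * \<bar>z\<bar> powr p))) \<partial>\<mu> t) =
    (\<integral>\<^sup>+s. ennreal (polya_density p l s * (\<integral>z. min \<bar>z\<bar> s \<partial>\<mu> t)) \<partial>lborel)"
    unfolding nn_integral_polya[OF sigma_finite_measure_axioms events_eq_borel p0 p(2) l]
  proof (rule nn_integral_cong)
    fix s
    show "ennreal (polya_density p l s) * (\<integral>\<^sup>+z. ennreal (min \<bar>z\<bar> s) \<partial>\<mu> t) = ennreal (polya_density p l s * (\<integral>z. min \<bar>z\<bar> s \<partial>\<mu> t))"
    proof (cases "0 < s")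
      case True
      then have "(\<integral>\<^sup>+z. ennreal (min \<bar>z\<bar> s) \<partial>\<mu> t) = ennreal (\<integral>z. min \<bar>z\<bar> s \<partial>\<mu> t)"
        using integrable_min_mu[of s t] t by (intro nn_integral_eq_integral) auto
      then show ?thesis using nn by (simp add: ennreal_mult')
    qed (simp add: polya_density_def)
  qed
  then show ?thesis
    using nn2 l by (subst (1 2) integral_eq_nn_integral) (auto intro!: AE_I2)
qed

text \<open>A second dominated convergence, now in the mixing variable s: \<open>bump_limit\<close>
  at y = 0 gives the pointwise limit and \<open>min_mu_bound\<close> the majorant.\<close>

lemma exp_limit:
  assumes p: "\<alpha> < p" "p \<le> 1" and l: "0 < l" and t: "\<And>n. 0 < t n" "t \<longlonglongrightarrow> 0"
  shows "(\<lambda>n. (\<integral>z. 1 - exp (- (l * \<bar>z\<bar> powr p)) \<partial>\<mu> (t n)) / t n) \<longlonglongrightarrow> (a + b) / \<alpha> * Gamma (1 - \<alpha> / p) * l powr (\<alpha> / p)"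
proof -
  have p0: "0 < p" using p alpha by simp
  note nn = polya_density_nonneg[OF p0 p(2) l]
  define K where "K = (a + b) / (\<alpha> * (1 - \<alpha>))"
  define B where "B = exponent_bound * powr_cos_kernel_mass \<alpha> / cos_kernel_mass"
  have K: "0 < K" using alpha coeffs by (simp add: K_def)
  have I: "has_bochner_integral lborel (\<lambda>s. polya_density p l s * (K * s powr (1 - \<alpha>))) ((a + b) / \<alpha> * Gamma (1 - \<alpha> / p) * l powr (\<alpha> / p))"
    unfolding K_def by (rule has_integral_polya_powr[OF p l])
  have "(\<lambda>n. \<integral>s. polya_density p l s * ((\<integral>z. min \<bar>z\<bar> s \<partial>\<mu> (t n)) / t n) \<partial>lborel) \<longlonglongrightarrow> (\<integral>s. polya_density p l s * (K * s powr (1 - \<alpha>)) \<partial>lborel)"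
  proof (rule integral_dominated_convergence)
    \<comment> \<open>The majorant is the constant B / K times the limit function, whose integral is
      known to be finite.\<close>
    have "integrable lborel (\<lambda>s. B / K * (polya_density p l s * (K * s powr (1 - \<alpha>))))"
      using I by (intro integrable_mult_right) (simp add: has_bochner_integral_iff)
    then show "integrable lborel (\<lambda>s. polya_density p l s * (B * s powr (1 - \<alpha>)))"
      using K by (simp add: mult.left_commute)
    show "AE s in lborel. (\<lambda>n. polya_density p l s * ((\<integral>z. min \<bar>z\<bar> s \<partial>\<mu> (t n)) / t n)) \<longlonglongrightarrow> polya_density p l s * (K * s powr (1 - \<alpha>))"
    proof (rule AE_I2)
      fix s :: real
      show "(\<lambda>n. polya_density p l s * ((\<integral>z. min \<bar>z\<bar> s \<partial>\<mu> (t n)) / t n)) \<longlonglongrightarrow> polya_density p l s * (K * s powr (1 - \<alpha>))"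
      proof (cases "0 < s")
        case True
        have "(\<integral>z. min \<bar>z\<bar> s \<partial>\<nu>) = K * s powr (1 - \<alpha>)"
          using nn_integral_stable_min[OF alpha coeffs(1,2), of s] True K
          by (subst integral_eq_nn_integral) (auto simp: K_def[symmetric])
        then show ?thesis using bump_limit[of s t 0, OF _ t] True by (intro tendsto_intros) simp
      qed (simp add: polya_density_def)
    qed
    show "AE s in lborel. norm (polya_density p l s * ((\<integral>z. min \<bar>z\<bar> s \<partial>\<mu> (t n)) / t n)) \<le> polya_density p l s * (B * s powr (1 - \<alpha>))" for n
    proof (rule AE_I2)
      fix s :: real
      show "norm (polya_density p l s * ((\<integral>z. min \<bar>z\<bar> s \<partial>\<mu> (t n)) / t n)) \<le> polya_density p l s * (B * s powr (1 - \<alpha>))"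
      proof (cases "0 < s")
        case True
        then have "0 \<le> (\<integral>z. min \<bar>z\<bar> s \<partial>\<mu> (t n)) / t n"
          using less_imp_le[OF t(1)] by (intro divide_nonneg_nonneg integral_nonneg_AE) auto
        then have "norm (polya_density p l s * ((\<integral>z. min \<bar>z\<bar> s \<partial>\<mu> (t n)) / t n)) = polya_density p l s * ((\<integral>z. min \<bar>z\<bar> s \<partial>\<mu> (t n)) / t n)"
          using nn[of s] by (subst real_norm_def, intro abs_of_nonneg mult_nonneg_nonneg) auto
        also have "\<dots> \<le> polya_density p l s * (B * s powr (1 - \<alpha>))"
          using min_mu_bound[of s "t n"] True t(1) nn by (intro mult_left_mono) (auto simp: B_def)
        finally show ?thesis .
      qed (simp add: polya_density_def)
    qed
    have "(\<lambda>s. \<integral>z. min \<bar>z\<bar> s \<partial>\<mu> (t n)) \<in> borel_measurable borel" for n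
    proof -
      interpret real_distribution "\<mu> (t n)" by (rule prob[OF t(1)])
      show ?thesis by measurable
    qed
    then show "(\<lambda>s. polya_density p l s * ((\<integral>z. min \<bar>z\<bar> s \<partial>\<mu> (t n)) / t n)) \<in> borel_measurable lborel" for n
      by simp
  qed measurable
  moreover have "(\<integral>s. polya_density p l s * ((\<integral>z. min \<bar>z\<bar> s \<partial>\<mu> (t n)) / t n) \<partial>lborel) = (\<integral>z. 1 - exp (- (l * \<bar>z\<bar> powr p)) \<partial>\<mu> (t n)) / t n" for n
    unfolding integral_exp_mu[OF p l t(1)] by (simp only: times_divide_eq_right integral_divide_zero)
  ultimately show ?thesis using I by (simp only: has_bochner_integral_iff)
qed

text \<open>The bump \<open>1 - min \<bar>z - y\<bar> 1\<close> has \<open>\<nu>\<close>-integral \<open>0\<close> if the \<open>\<mu> t\<close> do not charge its support.\<close>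

lemma no_jumps_near:
  assumes y: "1 \<le> \<bar>y\<bar>" and far: "\<And>t. 0 < t \<Longrightarrow> AE z in \<mu> t. 1 \<le> \<bar>z - y\<bar>"
  shows "AE z in \<nu>. 1 \<le> \<bar>z - y\<bar>"
proof -
  let ?g = "\<lambda>z::real. min \<bar>z - y\<bar> 1 - min \<bar>y\<bar> 1"
  have "(\<integral>z. ?g z \<partial>\<mu> t) = (\<integral>z. 0 \<partial>\<mu> t)" if "0 < t" for t
  proof (rule integral_cong_AE)
    interpret real_distribution "\<mu> t" by (rule prob[OF that])
    \<comment> \<open>As |y| \<ge> 1, the subtracted term equals 1, which cancels min |z - y|
      1.\<close>
    show "AE z in \<mu> t. ?g z = 0" using far[OF that] by eventually_elim (use y in simp)
    show "?g \<in> borel_measurable (\<mu> t)" by measurable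
  qed simp
  then have "(\<lambda>n. (\<integral>z. ?g z \<partial>\<mu> (inverse (real (Suc n)))) / inverse (real (Suc n))) = (\<lambda>n. 0)" by simp
  moreover have "(\<lambda>n. (\<integral>z. ?g z \<partial>\<mu> (inverse (real (Suc n)))) / inverse (real (Suc n))) \<longlonglongrightarrow> (\<integral>z. ?g z \<partial>\<nu>)"
    by (rule bump_limit) (use LIMSEQ_inverse_real_of_nat in auto)
  ultimately have "(\<integral>z. ?g z \<partial>\<nu>) = 0" using LIMSEQ_unique tendsto_const by metis
  then have "(\<integral>z. - ?g z \<partial>\<nu>) = 0" by (simp only: integral_minus minus_zero)
  moreover have "integrable \<nu> (\<lambda>z. - ?g z)" using bump_nu(1)[of 1 y] by (intro Bochner_Integration.integrable_minus) simp
  ultimately have "AE z in \<nu>. - ?g z = 0"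
    using y by (subst (asm) integral_nonneg_eq_0_iff_AE) auto
  then show ?thesis by eventually_elim (use y in linarith)
qed

lemma AE_density_stable:
  "(AE z in \<nu>. P z) \<Longrightarrow> AE z in lborel. (0 < a \<and> 0 < z \<or> 0 < b \<and> z < 0) \<longrightarrow> P z"
  unfolding stable_levy_measure_def
  by (subst (asm) AE_density) (use coeffs in \<open>auto elim!: eventually_mono\<close>)

lemma AE_lborel_meets_interval:
  assumes "u < v" "AE z in lborel. z \<notin> {u<..<v::real}" shows False
proof -
  have "emeasure lborel {u<..<v} = 0"
    using assms(2) by (subst (asm) AE_iff_measurable[of "{u<..<v}"]) auto
  then show False using assms(1) by simp
qed

text \<open>The bump of radius 1 around -2 lives on the interval from -3 to -1, which carries no
  mass of the marginal laws but has positive \<nu>-mass unless \<open>b\<close> vanishes.\<close>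

lemma no_negative_jumps:
  assumes "\<And>t. 0 < t \<Longrightarrow> AE z in \<mu> t. 0 \<le> z"
  shows "b = 0"
proof (rule ccontr)
  assume "b \<noteq> 0"
  have "AE z in \<nu>. 1 \<le> \<bar>z - (- 2)\<bar>"
  proof (rule no_jumps_near)
    show "AE z in \<mu> t. 1 \<le> \<bar>z - (- 2)\<bar>" if "0 < t" for t
      using assms[OF that] by eventually_elim simp
  qed simp
  from AE_density_stable[OF this] have "AE z in lborel. z \<notin> {- 3<..<- 1::real}"
    using \<open>b \<noteq> 0\<close> coeffs by (auto elim!: eventually_mono)
  then show False by (rule AE_lborel_meets_interval[rotated]) simp
qed

lemma no_positive_jumps:
  assumes "\<And>t. 0 < t \<Longrightarrow> AE z in \<mu> t. z \<le> 0"
  shows "a = 0"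
proof (rule ccontr)
  assume "a \<noteq> 0"
  have "AE z in \<nu>. 1 \<le> \<bar>z - 2\<bar>"
  proof (rule no_jumps_near)
    show "AE z in \<mu> t. 1 \<le> \<bar>z - 2\<bar>" if "0 < t" for t
      using assms[OF that] by eventually_elim simp
  qed simp
  from AE_density_stable[OF this] have "AE z in lborel. z \<notin> {1<..<3::real}"
    using \<open>a \<noteq> 0\<close> coeffs by (auto elim!: eventually_mono)
  then show False by (rule AE_lborel_meets_interval[rotated]) simp
qed

end

section \<open>The characteristic exponent\<close>

text \<open>Substituting k z yields the Jacobian k and the factor k^(- \<alpha> - 1) of the density,
  together k^(- \<alpha>). This homogeneity is later matched with the self-similarity of the
  process.\<close>

lemma stable_exponent_scale:
  assumes "0 \<le> a" "0 \<le> b" and k: "0 < k"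
  shows "stable_exponent \<alpha> a b (k * u) = complex_of_real (k powr \<alpha>) * stable_exponent \<alpha> a b u"
proof -
  let ?d = "\<lambda>z. a * z powr (-\<alpha> - 1) * indicator {0<..} z + b * \<bar>z\<bar> powr (-\<alpha> - 1) * indicator {..<0} z"
  have eq: "stable_exponent \<alpha> a b v = (\<integral>z. ?d z *\<^sub>R (1 - iexp (v * z)) \<partial>lborel)" for v
    unfolding stable_exponent_def stable_levy_measure_def
    by (rule integral_density) (use assms in auto)
  have "stable_exponent \<alpha> a b u = \<bar>k\<bar> *\<^sub>R (\<integral>z. ?d (0 + k * z) *\<^sub>R (1 - iexp (u * (0 + k * z))) \<partial>lborel)"
    unfolding eq by (rule lborel_integral_real_affine) (use k in simp)
  also have "(\<integral>z. ?d (0 + k * z) *\<^sub>R (1 - iexp (u * (0 + k * z))) \<partial>lborel) = (\<integral>z. k powr (- \<alpha> - 1) *\<^sub>R (?d z *\<^sub>R (1 - iexp (k * u * z))) \<partial>lborel)"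
  proof (rule Bochner_Integration.integral_cong[OF refl])
    fix z :: real
    have "?d (0 + k * z) = k powr (- \<alpha> - 1) * ?d z"
      using k by (auto simp: indicator_def zero_less_mult_iff mult_less_0_iff powr_mult abs_mult)
    then show "?d (0 + k * z) *\<^sub>R (1 - iexp (u * (0 + k * z))) = k powr (- \<alpha> - 1) *\<^sub>R (?d z *\<^sub>R (1 - iexp (k * u * z)))"
      by (simp add: mult_ac)
  qed
  also have "\<dots> = k powr (- \<alpha> - 1) *\<^sub>R stable_exponent \<alpha> a b (k * u)"
    unfolding eq by (rule integral_scaleR_right)
  finally have "stable_exponent \<alpha> a b u = (k * k powr (- \<alpha> - 1)) *\<^sub>R stable_exponent \<alpha> a b (k * u)"
    using k by simp
  also have "k * k powr (- \<alpha> - 1) = k powr (- \<alpha>)"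
    using k powr_add[of k 1 "- \<alpha> - 1"] by simp
  finally have "k powr \<alpha> *\<^sub>R stable_exponent \<alpha> a b u = (k powr \<alpha> * k powr (- \<alpha>)) *\<^sub>R stable_exponent \<alpha> a b (k * u)"
    by simp
  also have "k powr \<alpha> * k powr (- \<alpha>) = 1" using k by (simp add: powr_add[symmetric])
  finally show ?thesis by (simp add: scaleR_conv_of_real)
qed

text \<open>For \<alpha> < 1 the compensator, z on [-1, 1], is integrable on its own and can be
  absorbed into the drift.\<close>

lemma levy_khintchine_exponent_stable:
  assumes \<alpha>: "0 < \<alpha>" "\<alpha> < 1" and ab: "0 \<le> a" "0 \<le> b"
  shows "levy_khintchine_exponent c v (stable_levy_measure \<alpha> a b) u =
    \<i> * complex_of_real ((c - (\<integral>z. z * indicator {-1..1} z \<partial>stable_levy_measure \<alpha> a b)) * u)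
    - complex_of_real (v * u\<^sup>2 / 2) - stable_exponent \<alpha> a b u"
proof -
  let ?N = "stable_levy_measure \<alpha> a b"
  note i1 = integrable_stable_one_minus_iexp[OF \<alpha> ab, of u]
  have i2: "integrable ?N (\<lambda>z. z * indicator {-1..1} z)"
  proof (rule Bochner_Integration.integrable_bound)
    show "integrable ?N (\<lambda>z. min \<bar>z\<bar> 1)"
      by (rule integrableI_nonneg) (use nn_integral_stable_min[OF \<alpha> ab, of 1] in auto)
    show "AE z in ?N. norm (z * indicator {-1..1} z) \<le> norm (min \<bar>z\<bar> 1)"
      by (intro AE_I2) (auto simp: indicator_def)
  qed measurable
  have "(\<integral>z. iexp (u * z) - 1 - \<i> * complex_of_real (u * z * indicator {-1..1} z) \<partial>?N) =
    (\<integral>z. - (1 - iexp (u * z)) - \<i> * u * complex_of_real (z * indicator {-1..1} z) \<partial>?N)"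
    by (simp add: mult.assoc)
  also have "\<dots> = - stable_exponent \<alpha> a b u - \<i> * u * complex_of_real (\<integral>z. z * indicator {-1..1} z \<partial>?N)"
    unfolding stable_exponent_def
    by (intro has_bochner_integral_integral_eq has_bochner_integral_diff has_bochner_integral_minus
        has_bochner_integral_mult_right has_bochner_integral_of_real has_bochner_integral_integrable i1 i2)
  finally show ?thesis
    by (simp add: levy_khintchine_exponent_def algebra_simps)
qed

lemma strictly_stable_distr:
  assumes Z: "strictly_stable_process M \<alpha> Z" and k: "0 < k"
  shows "distr M borel (Z k) = distr M borel (\<lambda>\<omega>. k powr (1 / \<alpha>) * Z 1 \<omega>)"
proof -
  have meas[measurable]: "Z t \<in> borel_measurable M" if "0 \<le> t" for t
    using Z that by (auto simp: strictly_stable_process_def levy_process_def)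
  have proj: "distr (process_law M X) borel (\<lambda>x. x 1) = distr M borel (X 1)"
    if [measurable]: "\<And>t. 0 \<le> t \<Longrightarrow> X t \<in> borel_measurable M" for X :: "real \<Rightarrow> 'a \<Rightarrow> real"
  proof -
    have "(\<lambda>\<omega>. \<lambda>t\<in>{0..}. X t \<omega>) \<in> measurable M (\<Pi>\<^sub>M t\<in>{0..}. borel)"
      by (rule measurable_restrict) simp
    moreover have "(\<lambda>x. x (1::real)) \<in> measurable (\<Pi>\<^sub>M t\<in>{0..}. borel) (borel :: real measure)"
      by (rule measurable_component_singleton) simp
    ultimately show ?thesis
      unfolding process_law_def by (simp add: distr_distr comp_def)
  qed
  have "process_law M (\<lambda>t. Z (k * t)) = process_law M (\<lambda>t \<omega>. k powr (1 / \<alpha>) * Z t \<omega>)"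
    using Z k by (auto simp: strictly_stable_process_def)
  then have "distr M borel (Z (k * 1)) = distr M borel (\<lambda>\<omega>. k powr (1 / \<alpha>) * Z 1 \<omega>)"
    using proj[of "\<lambda>t. Z (k * t)"] proj[of "\<lambda>t \<omega>. k powr (1 / \<alpha>) * Z t \<omega>"] k by simp
  then show ?thesis by simp
qed

text \<open>Compare \<open>Z 2\<close> with \<open>r * Z 1\<close> in law, where r = 2^(1 /
  \<alpha>). The jump part has the right homogeneity and cancels; a drift would be multiplied by r
  instead of 2, a Gaussian variance by r^2 instead of 2. Since \<alpha> < 1 gives r > 2, both must
  vanish.\<close>

lemma strictly_stable_char:
  assumes \<alpha>: "0 < \<alpha>" "\<alpha> < 1" and ab: "0 \<le> a" "0 \<le> b"
    and Z: "strictly_stable_process M \<alpha> Z"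
    and nu: "has_levy_measure M Z (stable_levy_measure \<alpha> a b)"
    and t: "0 \<le> t"
  shows "char (distr M borel (Z t)) u = exp (- (t * stable_exponent \<alpha> a b u))"
proof -
  let ?\<psi> = "stable_exponent \<alpha> a b"
  have [measurable]: "Z t \<in> borel_measurable M" if "0 \<le> t" for t
    using Z that by (auto simp: strictly_stable_process_def levy_process_def)
  define m where "m = (\<integral>z. z * indicator {-1..1} z \<partial>stable_levy_measure \<alpha> a b)"
  obtain c v where v: "0 \<le> v" and ch: "\<And>t u. 0 \<le> t \<Longrightarrow> char (distr M borel (Z t)) u =
       exp (complex_of_real t * levy_khintchine_exponent c v (stable_levy_measure \<alpha> a b) u)"
    using nu by (auto simp: has_levy_measure_def)
  define d where "d = c - m"
  define r where "r = 2 powr (1 / \<alpha>)"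
  have r: "2 < r" using \<alpha> powr_less_mono[of 1 "1 / \<alpha>" 2] by (simp add: r_def)
  have scale: "?\<psi> (r * u) = 2 * ?\<psi> u" for u
    using stable_exponent_scale[OF ab, of r \<alpha> u] r \<alpha> by (simp add: r_def powr_powr)
  have ch: "char (distr M borel (Z t)) u = exp (t * (\<i> * (d * u) - v * u\<^sup>2 / 2 - ?\<psi> u))" if "0 \<le> t" for t u
    using ch[OF that] levy_khintchine_exponent_stable[OF \<alpha> ab] by (simp add: d_def m_def)
  have key: "exp (2 * (\<i> * (d * u) - v * u\<^sup>2 / 2 - ?\<psi> u)) = exp (\<i> * (d * (r * u)) - v * (r * u)\<^sup>2 / 2 - 2 * ?\<psi> u)" for u
  proof -
    have "char (distr M borel (Z 2)) u = char (distr M borel (Z 1)) (r * u)"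
      unfolding strictly_stable_distr[OF Z, of 2, simplified] char_def r_def
      by (simp add: integral_distr mult_ac)
    then show ?thesis using ch[of 2 u] ch[of 1 "r * u"] by (simp add: scale)
  qed
  have dv: "exp (\<i> * complex_of_real (d * (2 - r) * u) - complex_of_real (v * (2 - r\<^sup>2) * u\<^sup>2 / 2)) = 1" for u
  proof -
    have eq: "\<i> * complex_of_real (d * (2 - r) * u) - complex_of_real (v * (2 - r\<^sup>2) * u\<^sup>2 / 2) =
       2 * (\<i> * (d * u) - v * u\<^sup>2 / 2 - ?\<psi> u) - (\<i> * (d * (r * u)) - v * (r * u)\<^sup>2 / 2 - 2 * ?\<psi> u)"
      by (simp add: field_simps power_mult_distrib)
    then show ?thesis unfolding eq exp_diff key by simp
  qed
  have "v = 0"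
  proof -
    \<comment> \<open>The drift term is purely imaginary, so the modulus isolates the Gaussian
      part.\<close>
    have "cmod (exp (\<i> * complex_of_real (d * (2 - r) * 1) - complex_of_real (v * (2 - r\<^sup>2) * 1\<^sup>2 / 2))) = 1"
      unfolding dv by simp
    then have "v * (2 - r\<^sup>2) = 0" by simp
    moreover have "2 * 2 < r * r" using r by (intro mult_strict_mono) auto
    ultimately show ?thesis by (simp add: power2_eq_square)
  qed
  moreover have "d = 0"
  proof (rule ccontr)
    assume "d \<noteq> 0"
    \<comment> \<open>Equality of exponentials determines exponents only modulo 2 pi i; this
      argument makes the exponent pi i, where exp is -1 and not 1.\<close>
    then have "d * (2 - r) * (pi / (d * (2 - r))) = pi" using r by simp
    then have "exp (\<i> * complex_of_real pi) = 1"
      using dv[of "pi / (d * (2 - r))"] \<open>v = 0\<close> by simp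
    then show False by simp
  qed
  ultimately show ?thesis using ch[OF t] by simp
qed

section \<open>Laplace transform of the strong variation\<close>

text \<open>N x converges while N tends to infinity, hence x tends to 0; then N ln (1 - x) is
  squeezed between - N x - 2 N x^2 and - N x.\<close>

lemma tendsto_one_minus_power:
  fixes x :: "nat \<Rightarrow> real" and N :: "nat \<Rightarrow> nat"
  assumes x: "\<And>n. 0 \<le> x n" and N: "filterlim N at_top sequentially"
    and lim: "(\<lambda>n. real (N n) * x n) \<longlonglongrightarrow> c"
  shows "(\<lambda>n. (1 - x n) ^ N n) \<longlonglongrightarrow> exp (- c)"
proof -
  have Ninf: "filterlim (\<lambda>n. real (N n)) at_top sequentially"
    by (rule filterlim_compose[OF filterlim_real_sequentially N])
  have "(\<lambda>n. inverse (real (N n)) * (real (N n) * x n)) \<longlonglongrightarrow> 0 * c"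
    by (intro tendsto_mult lim tendsto_inverse_0_at_top Ninf)
  moreover have "\<forall>\<^sub>F n in sequentially. inverse (real (N n)) * (real (N n) * x n) = x n"
    using filterlim_at_top_dense[THEN iffD1, OF Ninf, rule_format, of 0] by eventually_elim simp
  ultimately have x0: "x \<longlonglongrightarrow> 0" by (simp add: tendsto_cong)
  have ev: "\<forall>\<^sub>F n in sequentially. x n < 1 / 2"
    using order_tendstoD(2)[OF x0, of "1 / 2"] by simp
  have "(\<lambda>n. real (N n) * ln (1 - x n)) \<longlonglongrightarrow> - c"
  proof (rule tendsto_sandwich)
    show "\<forall>\<^sub>F n in sequentially. - (real (N n) * x n) - 2 * (real (N n) * x n) * x n \<le> real (N n) * ln (1 - x n)"
      using ev
    proof eventually_elim
      fix n assume "x n < 1 / 2"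
      then have "- x n - 2 * (x n)\<^sup>2 \<le> ln (1 - x n)" using x[of n] by (intro ln_one_minus_pos_lower_bound) auto
      then have "real (N n) * (- x n - 2 * (x n)\<^sup>2) \<le> real (N n) * ln (1 - x n)" by (intro mult_left_mono) auto
      then show "- (real (N n) * x n) - 2 * (real (N n) * x n) * x n \<le> real (N n) * ln (1 - x n)"
        by (simp add: power2_eq_square algebra_simps)
    qed
    show "\<forall>\<^sub>F n in sequentially. real (N n) * ln (1 - x n) \<le> - (real (N n) * x n)"
      using ev
    proof eventually_elim
      fix n assume "x n < 1 / 2"
      then have "ln (1 - x n) \<le> - x n" using ln_le_minus_one[of "1 - x n"] by simp
      then have "real (N n) * ln (1 - x n) \<le> real (N n) * (- x n)" by (intro mult_left_mono) auto
      then show "real (N n) * ln (1 - x n) \<le> - (real (N n) * x n)" by simp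
    qed
    have "(\<lambda>n. - (real (N n) * x n) - 2 * (real (N n) * x n) * x n) \<longlonglongrightarrow> - c - 2 * c * 0"
      by (intro tendsto_intros lim x0)
    then show "(\<lambda>n. - (real (N n) * x n) - 2 * (real (N n) * x n) * x n) \<longlonglongrightarrow> - c" by simp
    show "(\<lambda>n. - (real (N n) * x n)) \<longlonglongrightarrow> - c" by (intro tendsto_intros lim)
  qed
  then have "(\<lambda>n. exp (real (N n) * ln (1 - x n))) \<longlonglongrightarrow> exp (- c)" by (rule tendsto_exp)
  moreover have "\<forall>\<^sub>F n in sequentially. exp (real (N n) * ln (1 - x n)) = (1 - x n) ^ N n"
    using ev by eventually_elim (simp add: exp_of_nat_mult)
  ultimately show ?thesis by (simp add: tendsto_cong)
qed

text \<open>The limit 0 in the infinite case is written out because \<open>enn2real\<close> sends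
  infinity to 0, where the exponential would be 1.\<close>

lemma tendsto_exp_minus_ennreal:
  fixes V :: "nat \<Rightarrow> real"
  assumes V: "\<And>n. 0 \<le> V n" and lim: "(\<lambda>n. ennreal (V n)) \<longlonglongrightarrow> S" and l: "0 < l"
  shows "(\<lambda>n. exp (- (l * V n))) \<longlonglongrightarrow> (if S = \<infinity> then 0 else exp (- (l * enn2real S)))"
proof (cases S)
  case (real r)
  then have "V \<longlonglongrightarrow> r" using lim V by (simp add: tendsto_ennreal_iff)
  then show ?thesis using real by (auto intro!: tendsto_intros)
next
  case top
  have "filterlim V at_top sequentially"
    unfolding filterlim_at_top_dense
  proof
    fix Z :: real
    have "\<forall>\<^sub>F n in sequentially. ennreal Z < ennreal (V n)"
      using lim top by (auto intro: order_tendstoD)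
    then show "\<forall>\<^sub>F n in sequentially. Z < V n"
      by eventually_elim (metis ennreal_leI not_le)
  qed
  then have "filterlim (\<lambda>n. l * V n) at_top sequentially"
    by (rule filterlim_tendsto_pos_mult_at_top[OF tendsto_const l])
  then have "(\<lambda>n. exp (- (l * V n))) \<longlonglongrightarrow> 0"
    by (intro filterlim_compose[OF exp_at_bot]) (simp add: filterlim_uminus_at_bot)
  then show ?thesis using top by simp
qed

lemma psum_nonneg: "0 \<le> psum p f t k"
  unfolding psum_def by (rule sum_nonneg) simp

lemma levy_process_measurable:
  "levy_process M Z \<Longrightarrow> 0 \<le> t \<Longrightarrow> Z t \<in> borel_measurable M"
  by (simp add: levy_process_def)

lemma pvar_sup_measurable:
  assumes Z: "levy_process M Z" and p: "0 < p"
  shows "(\<lambda>\<omega>. pvar_sup p (\<lambda>t. Z t \<omega>)) \<in> borel_measurable M"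
proof -
  note [measurable] = levy_process_measurable[OF Z]
  have "(\<lambda>\<omega>. SUP (n, m) \<in> dyadic_partitions. ennreal (psum p (\<lambda>t. Z t \<omega>) (\<lambda>j. real (m ! j) / 2 ^ n) (length m - 1))) \<in> borel_measurable M"
    unfolding psum_def case_prod_beta
    by (rule borel_measurable_SUP) auto
  moreover have "pvar_sup p (\<lambda>t. Z t \<omega>) = (SUP (n, m) \<in> dyadic_partitions. ennreal (psum p (\<lambda>t. Z t \<omega>) (\<lambda>j. real (m ! j) / 2 ^ n) (length m - 1)))"
    if "\<omega> \<in> space M" for \<omega>
    using Z that by (intro pvar_sup_dyadic p) (auto simp: levy_process_def)
  ultimately show ?thesis by (subst measurable_cong) auto
qed

lemma laplace_dyadic_sum:
  assumes Z: "levy_process M Z" and l: "0 \<le> l"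
  shows "(\<integral>\<omega>. exp (- (l * dyadic_sum p (\<lambda>t. Z t \<omega>) n)) \<partial>M) =
     (\<integral>z. exp (- (l * \<bar>z\<bar> powr p)) \<partial>distr M borel (Z (1 / 2 ^ n))) ^ (2 ^ n)"
proof -
  interpret prob_space M using Z by (simp add: levy_process_def)
  note [measurable] = levy_process_measurable[OF Z]
  let ?t = "\<lambda>i. real i / 2 ^ n"
  let ?D = "\<lambda>i \<omega>. Z (?t (Suc i)) \<omega> - Z (?t i) \<omega>"
  let ?g = "\<lambda>x::real. exp (- (l * \<bar>x\<bar> powr p))"
  have "\<forall>(n::nat) (t::nat \<Rightarrow> real). 0 \<le> t 0 \<longrightarrow> (\<forall>i<n. t i \<le> t (Suc i)) \<longrightarrow>
        indep_vars (\<lambda>_. borel) (\<lambda>i \<omega>. Z (t (Suc i)) \<omega> - Z (t i) \<omega>) {..<n}"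
    using Z by (simp add: levy_process_def)
  from this[rule_format, of ?t "2 ^ n"] have "indep_vars (\<lambda>_. borel) ?D {..<2 ^ n}"
    by (simp add: divide_right_mono)
  then have ind: "indep_vars (\<lambda>_. borel) (\<lambda>i \<omega>. ?g (?D i \<omega>)) {..<2 ^ n}"
    by (rule indep_vars_compose2) measurable
  have eq: "exp (- (l * dyadic_sum p (\<lambda>t. Z t \<omega>) n)) = (\<Prod>i<2 ^ n. ?g (?D i \<omega>))" for \<omega>
  proof -
    have "dyadic_sum p (\<lambda>t. Z t \<omega>) n = (\<Sum>i<2 ^ n. \<bar>?D i \<omega>\<bar> powr p)"
      unfolding dyadic_sum_def psum_def
      by (rule sum.reindex_bij_witness[of _ Suc "\<lambda>i. i - 1"]) auto
    then show ?thesis by (simp add: exp_sum sum_distrib_left sum_negf[symmetric])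
  qed
  have "(\<integral>\<omega>. exp (- (l * dyadic_sum p (\<lambda>t. Z t \<omega>) n)) \<partial>M) = (\<Prod>i<2 ^ n. \<integral>\<omega>. ?g (?D i \<omega>) \<partial>M)"
    unfolding eq
  proof (rule indep_vars_lebesgue_integral)
    show "integrable M (\<lambda>\<omega>. ?g (?D i \<omega>))" if "i \<in> {..<2 ^ n}" for i
      by (rule integrable_const_bound[of _ 1]) (use l in auto)
  qed (use ind in auto)
  also have "\<dots> = (\<Prod>i<(2::nat) ^ n. \<integral>z. ?g z \<partial>distr M borel (Z (1 / 2 ^ n)))"
  proof (rule prod.cong[OF refl])
    fix i
    have "\<forall>s\<ge>0. \<forall>h\<ge>0. distr M borel (\<lambda>\<omega>. Z (s + h) \<omega> - Z s \<omega>) = distr M borel (Z h)"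
      using Z by (simp add: levy_process_def)
    then have "distr M borel (\<lambda>\<omega>. Z (?t i + 1 / 2 ^ n) \<omega> - Z (?t i) \<omega>) = distr M borel (Z (1 / 2 ^ n))"
      by simp
    moreover have "?t i + 1 / 2 ^ n = ?t (Suc i)" by (simp add: add_divide_distrib)
    ultimately have d: "distr M borel (?D i) = distr M borel (Z (1 / 2 ^ n))" by simp
    have "(\<integral>\<omega>. ?g (?D i \<omega>) \<partial>M) = (\<integral>z. ?g z \<partial>distr M borel (?D i))"
      by (subst integral_distr) auto
    then show "(\<integral>\<omega>. ?g (?D i \<omega>) \<partial>M) = (\<integral>z. ?g z \<partial>distr M borel (Z (1 / 2 ^ n)))"
      unfolding d .
  qed
  finally show ?thesis by simp
qed

section \<open>From the marginals to the variation of the process\<close>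

locale strictly_stable_levy =
  fixes M :: "'a measure" and Z :: "real \<Rightarrow> 'a \<Rightarrow> real" and \<alpha> a b :: real
  assumes \<alpha>: "0 < \<alpha>" "\<alpha> < 1" and ab: "0 \<le> a" "0 \<le> b" "0 < a + b"
    and Z: "strictly_stable_process M \<alpha> Z"
    and nu: "has_levy_measure M Z (stable_levy_measure \<alpha> a b)"
begin

lemma levy: "levy_process M Z"
  using Z by (simp add: strictly_stable_process_def)

lemma meas[measurable]: "0 \<le> t \<Longrightarrow> Z t \<in> borel_measurable M"
  by (rule levy_process_measurable[OF levy])

sublocale prob_space M
  using levy by (simp add: levy_process_def)

sublocale stable_marginals \<alpha> a b "\<lambda>t. distr M borel (Z t)"
proof (rule stable_marginals.intro)
  fix t :: real assume t: "0 < t"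
  then show "real_distribution (distr M borel (Z t))"
    by (intro real_distribution_distr) simp
  show "char (distr M borel (Z t)) u = exp (- (t * stable_exponent \<alpha> a b u))" for u
    by (rule strictly_stable_char[OF \<alpha> ab(1,2) Z nu]) (use t in simp)
qed (use \<alpha> ab in auto)

text \<open>The dyadic Laplace transforms are evaluated in the limit twice: pathwise, by bounded
  convergence, giving the left-hand side, and through the small-time behaviour of one increment,
  giving the right-hand side.\<close>

lemma laplace_pvar_sup:
  assumes p: "\<alpha> < p" "p \<le> 1" and l: "0 < l"
  shows "(\<integral>\<omega>. (if pvar_sup p (\<lambda>t. Z t \<omega>) = \<infinity> then 0 else exp (- (l * enn2real (pvar_sup p (\<lambda>t. Z t \<omega>))))) \<partial>M)
    = exp (- ((a + b) / \<alpha> * Gamma (1 - \<alpha> / p) * l powr (\<alpha> / p)))"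
proof (rule LIMSEQ_unique)
  have p0: "0 < p" using p \<alpha> by simp
  have nonneg: "0 \<le> dyadic_sum p f n" for f n
    by (simp add: dyadic_sum_def psum_nonneg)
  note [measurable] = pvar_sup_measurable[OF levy p0]
  have dm[measurable]: "(\<lambda>\<omega>. dyadic_sum p (\<lambda>t. Z t \<omega>) n) \<in> borel_measurable M" for n
    unfolding dyadic_sum_def psum_def by (intro borel_measurable_sum) measurable
  show "(\<lambda>n. \<integral>\<omega>. exp (- (l * dyadic_sum p (\<lambda>t. Z t \<omega>) n)) \<partial>M) \<longlonglongrightarrow>
    (\<integral>\<omega>. (if pvar_sup p (\<lambda>t. Z t \<omega>) = \<infinity> then 0 else exp (- (l * enn2real (pvar_sup p (\<lambda>t. Z t \<omega>))))) \<partial>M)"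
  proof (rule integral_dominated_convergence[where w="\<lambda>_. 1"])
    show "AE \<omega> in M. (\<lambda>n. exp (- (l * dyadic_sum p (\<lambda>t. Z t \<omega>) n))) \<longlonglongrightarrow>
       (if pvar_sup p (\<lambda>t. Z t \<omega>) = \<infinity> then 0 else exp (- (l * enn2real (pvar_sup p (\<lambda>t. Z t \<omega>)))))"
    proof (rule AE_I2)
      fix \<omega> assume "\<omega> \<in> space M"
      then have "cadlag (\<lambda>t. Z t \<omega>)" using levy by (simp add: levy_process_def)
      then show "(\<lambda>n. exp (- (l * dyadic_sum p (\<lambda>t. Z t \<omega>) n))) \<longlonglongrightarrow>
       (if pvar_sup p (\<lambda>t. Z t \<omega>) = \<infinity> then 0 else exp (- (l * enn2real (pvar_sup p (\<lambda>t. Z t \<omega>)))))"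
        by (intro tendsto_exp_minus_ennreal nonneg l pvar_sup_LIMSEQ p0 p)
    qed
  qed (use l nonneg in auto)
  \<comment> \<open>One minus the Laplace integral of a single dyadic increment; multiplied by 2^n
    it converges by \<open>exp_limit\<close>.\<close>
  let ?x = "\<lambda>n. \<integral>z. 1 - exp (- (l * \<bar>z\<bar> powr p)) \<partial>distr M borel (Z (1 / 2 ^ n))"
  have lap: "(\<integral>\<omega>. exp (- (l * dyadic_sum p (\<lambda>t. Z t \<omega>) n)) \<partial>M) = (1 - ?x n) ^ (2 ^ n)" for n
  proof -
    interpret D: real_distribution "distr M borel (Z (1 / 2 ^ n))" by (rule prob) simp
    have "integrable (distr M borel (Z (1 / 2 ^ n))) (\<lambda>z. exp (- (l * \<bar>z\<bar> powr p)))"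
      by (rule D.integrable_const_bound[of _ 1]) (use l in auto)
    then have "?x n = 1 - (\<integral>z. exp (- (l * \<bar>z\<bar> powr p)) \<partial>distr M borel (Z (1 / 2 ^ n)))"
      using D.prob_space by (subst Bochner_Integration.integral_diff) auto
    then show ?thesis using laplace_dyadic_sum[OF levy, of l p n] l by simp
  qed
  have "(\<lambda>n. ?x n / (1 / 2 ^ n)) \<longlonglongrightarrow> (a + b) / \<alpha> * Gamma (1 - \<alpha> / p) * l powr (\<alpha> / p)"
  proof (rule exp_limit[OF p l])
    show "(\<lambda>n. 1 / 2 ^ n :: real) \<longlonglongrightarrow> 0" by real_asymp
  qed simp
  then have "(\<lambda>n. real (2 ^ n) * ?x n) \<longlonglongrightarrow> (a + b) / \<alpha> * Gamma (1 - \<alpha> / p) * l powr (\<alpha> / p)"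
    by (simp add: mult.commute)
  then show "(\<lambda>n. \<integral>\<omega>. exp (- (l * dyadic_sum p (\<lambda>t. Z t \<omega>) n)) \<partial>M) \<longlonglongrightarrow>
     exp (- ((a + b) / \<alpha> * Gamma (1 - \<alpha> / p) * l powr (\<alpha> / p)))"
    unfolding lap
  proof (rule tendsto_one_minus_power[rotated 2])
    show "0 \<le> ?x n" for n using l by (intro integral_nonneg_AE) auto
    show "filterlim (\<lambda>n. 2 ^ n :: nat) at_top sequentially" by (rule filterlim_subseq) (simp add: strict_mono_Suc_iff)
  qed
qed

text \<open>The event says that the supremum is at most \<epsilon>^p, so the Tauberian theorem is
  used with \<beta> = \<alpha> / p at d = \<epsilon>^p. The product \<kappa> \<beta> then becomes (a
  + b) / p * Gamma (1 - \<alpha> / p), and the exponent p \<beta> / (1 - \<beta>) becomes p \<alpha>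
  / (p - \<alpha>).\<close>

lemma small_deviation:
  assumes p: "\<alpha> < p" "p \<le> 1"
  shows "((\<lambda>\<epsilon>. \<epsilon> powr (p * \<alpha> / (p - \<alpha>)) *
      ln (measure M {\<omega> \<in> space M. strong_pvar p (\<lambda>t. Z t \<omega>) \<le> ennreal \<epsilon>}))
    \<longlongrightarrow> - ((p - \<alpha>) / \<alpha>) * ((a + b) / p * Gamma (1 - \<alpha> / p)) powr (p / (p - \<alpha>))) (at_right 0)"
proof -
  have p0: "0 < p" using p \<alpha> by simp
  define S where "S \<omega> = pvar_sup p (\<lambda>t. Z t \<omega>)" for \<omega>
  have [measurable]: "S \<in> borel_measurable M"
    unfolding S_def[abs_def] by (rule pvar_sup_measurable[OF levy p0])
  \<comment> \<open>Paths of infinite variation have to be removed: \<open>enn2real\<close> would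
    turn their variation into 0 and count them as small.\<close>
  define A where "A = {\<omega> \<in> space M. S \<omega> \<noteq> \<infinity>}"
  have A[measurable]: "A \<in> sets M" unfolding A_def by measurable
  define N where "N = restrict_space M A"
  define \<kappa> where "\<kappa> = (a + b) / \<alpha> * Gamma (1 - \<alpha> / p)"
  define \<beta> where "\<beta> = \<alpha> / p"
  have \<beta>: "0 < \<beta>" "\<beta> < 1" using \<alpha> p p0 by (auto simp: \<beta>_def)
  have \<kappa>: "0 < \<kappa>" using \<alpha> ab \<beta> by (auto simp: \<kappa>_def \<beta>_def intro!: mult_pos_pos Gamma_real_pos)
  have AS: "A \<inter> space M \<in> sets M" using A by (simp add: sets.Int_space_eq2)
  have lim: "((\<lambda>d. d powr (\<beta> / (1 - \<beta>)) * ln (measure N {x \<in> space N. enn2real (S x) \<le> d}))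
    \<longlongrightarrow> - ((1 - \<beta>) / \<beta>) * (\<kappa> * \<beta>) powr (1 / (1 - \<beta>))) (at_right 0)"
  proof (rule de_bruijn_tauberian[OF _ _ _ \<beta> \<kappa>])
    show "finite_measure N" unfolding N_def by (rule finite_measure_restrict_space) (use AS in \<open>simp_all add: finite_measure_axioms\<close>)
    show "(\<lambda>x. enn2real (S x)) \<in> borel_measurable N" unfolding N_def by (intro measurable_restrict_space1) measurable
    fix l :: real assume l: "0 < l"
    have "(\<integral>x. exp (- (l * enn2real (S x))) \<partial>N) = (\<integral>x. indicator A x *\<^sub>R exp (- (l * enn2real (S x))) \<partial>M)"
      unfolding N_def by (rule integral_restrict_space[OF AS])
    also have "\<dots> = (\<integral>\<omega>. (if S \<omega> = \<infinity> then 0 else exp (- (l * enn2real (S \<omega>)))) \<partial>M)"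
      by (intro Bochner_Integration.integral_cong) (auto simp: A_def)
    also have "\<dots> = exp (- (\<kappa> * l powr \<beta>))"
      unfolding S_def \<kappa>_def \<beta>_def by (rule laplace_pvar_sup[OF p l])
    finally show "(\<integral>x. exp (- (l * enn2real (S x))) \<partial>N) = exp (- (\<kappa> * l powr \<beta>))" .
  qed simp
  have "filterlim (\<lambda>e::real. e powr p) (at_right 0) (at_right 0)"
    using p0 by real_asymp
  from filterlim_compose[OF lim this]
  have "((\<lambda>e. (e powr p) powr (\<beta> / (1 - \<beta>)) * ln (measure N {x \<in> space N. enn2real (S x) \<le> e powr p}))
    \<longlongrightarrow> - ((1 - \<beta>) / \<beta>) * (\<kappa> * \<beta>) powr (1 / (1 - \<beta>))) (at_right 0)" .
  also have "- ((1 - \<beta>) / \<beta>) * (\<kappa> * \<beta>) powr (1 / (1 - \<beta>)) = - ((p - \<alpha>) / \<alpha>) * ((a + b) / p * Gamma (1 - \<alpha> / p)) powr (p / (p - \<alpha>))"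
  proof -
    have "(1 - \<beta>) / \<beta> = (p - \<alpha>) / \<alpha>" "1 / (1 - \<beta>) = p / (p - \<alpha>)" "\<kappa> * \<beta> = (a + b) / p * Gamma (1 - \<alpha> / p)"
      using p0 p \<alpha> by (simp_all add: \<beta>_def \<kappa>_def field_simps)
    then show ?thesis by simp
  qed
  finally show ?thesis
  proof (rule tendsto_cong[THEN iffD1, rotated])
    show "\<forall>\<^sub>F e in at_right 0. (e powr p) powr (\<beta> / (1 - \<beta>)) * ln (measure N {x \<in> space N. enn2real (S x) \<le> e powr p}) =
      e powr (p * \<alpha> / (p - \<alpha>)) * ln (measure M {\<omega> \<in> space M. strong_pvar p (\<lambda>t. Z t \<omega>) \<le> ennreal e})"
      using eventually_at_right_less[of 0]
    proof eventually_elim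
      fix e :: real assume e: "0 < e"
      have "1 - \<beta> = (p - \<alpha>) / p" using p0 by (simp add: \<beta>_def diff_divide_distrib)
      then have "p * (\<beta> / (1 - \<beta>)) = p * \<alpha> / (p - \<alpha>)" using p0 by (simp add: \<beta>_def)
      moreover have "{x \<in> space N. enn2real (S x) \<le> e powr p} = {\<omega> \<in> space M. strong_pvar p (\<lambda>t. Z t \<omega>) \<le> ennreal e}"
      proof (intro set_eqI)
        fix x
        show "x \<in> {x \<in> space N. enn2real (S x) \<le> e powr p} \<longleftrightarrow> x \<in> {\<omega> \<in> space M. strong_pvar p (\<lambda>t. Z t \<omega>) \<le> ennreal e}"
          unfolding mem_Collect_eq strong_pvar_le_iff[OF p0 e] S_def[symmetric]
          by (cases "S x") (auto simp: N_def A_def space_restrict_space top_unique)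
      qed
      moreover have "measure N {x \<in> space N. enn2real (S x) \<le> e powr p} = measure M {x \<in> space N. enn2real (S x) \<le> e powr p}"
        unfolding N_def by (rule measure_restrict_space[OF AS]) (auto simp: space_restrict_space)
      ultimately show "(e powr p) powr (\<beta> / (1 - \<beta>)) * ln (measure N {x \<in> space N. enn2real (S x) \<le> e powr p}) =
        e powr (p * \<alpha> / (p - \<alpha>)) * ln (measure M {\<omega> \<in> space M. strong_pvar p (\<lambda>t. Z t \<omega>) \<le> ennreal e})"
        by (simp add: powr_powr)
    qed
  qed
qed

text \<open>The sign \<open>c\<close> treats subordinators and their negatives together. On a
  monotone path the variation is the same for all exponents from 1 on. Monotonicity holds only
  almost surely, so the events agree up to a null set and both have to be measurable.\<close>

lemma measure_strong_pvar_eq: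
  assumes p: "1 \<le> p" and e: "0 < e"
    and mono: "AE \<omega> in M. \<forall>s t. 0 \<le> s \<longrightarrow> s \<le> t \<longrightarrow> c * Z s \<omega> \<le> c * Z t \<omega>" and c: "c = 1 \<or> c = - 1"
  shows "measure M {\<omega> \<in> space M. strong_pvar p (\<lambda>t. Z t \<omega>) \<le> ennreal e} =
    measure M {\<omega> \<in> space M. strong_pvar 1 (\<lambda>t. Z t \<omega>) \<le> ennreal e}"
proof (rule measure_eq_AE)
  have sets: "{\<omega> \<in> space M. strong_pvar q (\<lambda>t. Z t \<omega>) \<le> ennreal e} \<in> sets M" if "1 \<le> q" for q
  proof -
    have [measurable]: "(\<lambda>\<omega>. pvar_sup q (\<lambda>t. Z t \<omega>)) \<in> borel_measurable M"
      by (rule pvar_sup_measurable[OF levy]) (use that in simp)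
    show ?thesis using that e by (subst strong_pvar_le_iff) simp_all
  qed
  show "{\<omega> \<in> space M. strong_pvar p (\<lambda>t. Z t \<omega>) \<le> ennreal e} \<in> sets M"
    "{\<omega> \<in> space M. strong_pvar 1 (\<lambda>t. Z t \<omega>) \<le> ennreal e} \<in> sets M"
    using p by (auto intro: sets)
  show "AE \<omega> in M. (\<omega> \<in> {\<omega> \<in> space M. strong_pvar p (\<lambda>t. Z t \<omega>) \<le> ennreal e}) =
    (\<omega> \<in> {\<omega> \<in> space M. strong_pvar 1 (\<lambda>t. Z t \<omega>) \<le> ennreal e})"
    using mono
  proof eventually_elim
    fix \<omega> assume "\<forall>s t. 0 \<le> s \<longrightarrow> s \<le> t \<longrightarrow> c * Z s \<omega> \<le> c * Z t \<omega>"
    then have "strong_pvar p (\<lambda>t. c * Z t \<omega>) = strong_pvar 1 (\<lambda>t. c * Z t \<omega>)"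
      using strong_pvar_mono[of "\<lambda>t. c * Z t \<omega>" p] strong_pvar_mono[of "\<lambda>t. c * Z t \<omega>" 1] p by simp
    then have "strong_pvar p (\<lambda>t. Z t \<omega>) = strong_pvar 1 (\<lambda>t. Z t \<omega>)"
      using c by (auto simp: strong_pvar_uminus)
    then show "(\<omega> \<in> {\<omega> \<in> space M. strong_pvar p (\<lambda>t. Z t \<omega>) \<le> ennreal e}) =
      (\<omega> \<in> {\<omega> \<in> space M. strong_pvar 1 (\<lambda>t. Z t \<omega>) \<le> ennreal e})" by simp
  qed
qed

text \<open>The limit for exponent 1 is carried over. Its constant still contains the sum a + b,
  which the sign of the jumps reduces to one coefficient afterwards.\<close>

lemma small_deviation_monotone:
  assumes p: "1 < p"
    and mono: "AE \<omega> in M. \<forall>s t. 0 \<le> s \<longrightarrow> s \<le> t \<longrightarrow> c * Z s \<omega> \<le> c * Z t \<omega>" and c: "c = 1 \<or> c = - 1"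
  shows "((\<lambda>\<epsilon>. \<epsilon> powr (\<alpha> / (1 - \<alpha>)) *
      ln (measure M {\<omega> \<in> space M. strong_pvar p (\<lambda>t. Z t \<omega>) \<le> ennreal \<epsilon>}))
    \<longlongrightarrow> - (1 / \<alpha> - 1) * ((a + b) * Gamma (1 - \<alpha>)) powr (1 / (1 - \<alpha>))) (at_right 0)"
proof -
  have "(1 - \<alpha>) / \<alpha> = 1 / \<alpha> - 1" using \<alpha> by (simp add: field_simps)
  then have "((\<lambda>\<epsilon>. \<epsilon> powr (\<alpha> / (1 - \<alpha>)) *
      ln (measure M {\<omega> \<in> space M. strong_pvar 1 (\<lambda>t. Z t \<omega>) \<le> ennreal \<epsilon>}))
    \<longlongrightarrow> - (1 / \<alpha> - 1) * ((a + b) * Gamma (1 - \<alpha>)) powr (1 / (1 - \<alpha>))) (at_right 0)"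
    using small_deviation[of 1] \<alpha> by simp
  then show ?thesis
  proof (rule tendsto_cong[THEN iffD1, rotated])
    show "\<forall>\<^sub>F e in at_right 0. e powr (\<alpha> / (1 - \<alpha>)) * ln (measure M {\<omega> \<in> space M. strong_pvar 1 (\<lambda>t. Z t \<omega>) \<le> ennreal e}) =
       e powr (\<alpha> / (1 - \<alpha>)) * ln (measure M {\<omega> \<in> space M. strong_pvar p (\<lambda>t. Z t \<omega>) \<le> ennreal e})"
      using eventually_at_right_less[of 0]
      by eventually_elim (subst measure_strong_pvar_eq[OF _ _ mono c, of p], use p in simp_all)
  qed
qed

text \<open>Monotone paths that start at 0 have marginals of one sign, the form in which
  \<open>no_negative_jumps\<close> and \<open>no_positive_jumps\<close> use monotonicity.\<close>

lemma AE_sign: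
  assumes mono: "AE \<omega> in M. \<forall>s t. 0 \<le> s \<longrightarrow> s \<le> t \<longrightarrow> c * Z s \<omega> \<le> c * Z t \<omega>" and t: "0 < t"
  shows "AE z in distr M borel (Z t). 0 \<le> c * z"
proof (subst AE_distr_iff)
  have "AE \<omega> in M. Z 0 \<omega> = 0" using levy by (simp add: levy_process_def)
  then show "AE \<omega> in M. 0 \<le> c * Z t \<omega>" using mono
  proof eventually_elim
    fix \<omega> assume "Z 0 \<omega> = 0" "\<forall>s t. 0 \<le> s \<longrightarrow> s \<le> t \<longrightarrow> c * Z s \<omega> \<le> c * Z t \<omega>"
    then have "c * Z 0 \<omega> \<le> c * Z t \<omega>" using t less_imp_le by blast
    then show "0 \<le> c * Z t \<omega>" using \<open>Z 0 \<omega> = 0\<close> by simp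
  qed
  show "Z t \<in> measurable M borel" using t by simp
  show "{z \<in> space borel. 0 \<le> c * z} \<in> sets borel" by measurable
qed

end

theorem proposition1:
  fixes M :: "'a measure" and Z :: "real \<Rightarrow> 'a \<Rightarrow> real" and \<alpha> c\<^sub>p c\<^sub>m :: real
  assumes "\<alpha> \<in> {0<..<1}" and "0 \<le> c\<^sub>p" and "0 \<le> c\<^sub>m" and "0 < c\<^sub>p + c\<^sub>m"
    and "strictly_stable_process M \<alpha> Z"
    and "has_levy_measure M Z (stable_levy_measure \<alpha> c\<^sub>p c\<^sub>m)"
  shows "(\<forall>p\<in>{\<alpha><..1}.
            ((\<lambda>\<epsilon>. \<epsilon> powr (p * \<alpha> / (p - \<alpha>)) *
                 ln (measure M {\<omega> \<in> space M. strong_pvar p (\<lambda>t. Z t \<omega>) \<le> ennreal \<epsilon>}))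
              \<longlongrightarrow> - ((p - \<alpha>) / \<alpha>) * ((c\<^sub>m + c\<^sub>p) / p * Gamma (1 - \<alpha> / p)) powr (p / (p - \<alpha>)))
            (at_right 0)) \<and>
         (subordinator M Z \<longrightarrow> (\<forall>p>1.
            ((\<lambda>\<epsilon>. \<epsilon> powr (\<alpha> / (1 - \<alpha>)) *
                 ln (measure M {\<omega> \<in> space M. strong_pvar p (\<lambda>t. Z t \<omega>) \<le> ennreal \<epsilon>}))
              \<longlongrightarrow> - (1 / \<alpha> - 1) * (c\<^sub>p * Gamma (1 - \<alpha>)) powr (1 / (1 - \<alpha>))) (at_right 0))) \<and>
         (subordinator M (\<lambda>t \<omega>. - Z t \<omega>) \<longrightarrow> (\<forall>p>1.
            ((\<lambda>\<epsilon>. \<epsilon> powr (\<alpha> / (1 - \<alpha>)) *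
                 ln (measure M {\<omega> \<in> space M. strong_pvar p (\<lambda>t. Z t \<omega>) \<le> ennreal \<epsilon>}))
              \<longlongrightarrow> - (1 / \<alpha> - 1) * (c\<^sub>m * Gamma (1 - \<alpha>)) powr (1 / (1 - \<alpha>))) (at_right 0)))"
proof -
  interpret strictly_stable_levy M Z \<alpha> c\<^sub>p c\<^sub>m
    by (rule strictly_stable_levy.intro) (use assms in simp_all)
  show ?thesis
  proof (intro conjI ballI impI allI)
    fix p assume "p \<in> {\<alpha><..1}"
    then show "((\<lambda>\<epsilon>. \<epsilon> powr (p * \<alpha> / (p - \<alpha>)) *
          ln (measure M {\<omega> \<in> space M. strong_pvar p (\<lambda>t. Z t \<omega>) \<le> ennreal \<epsilon>}))
        \<longlongrightarrow> - ((p - \<alpha>) / \<alpha>) * ((c\<^sub>m + c\<^sub>p) / p * Gamma (1 - \<alpha> / p)) powr (p / (p - \<alpha>))) (at_right 0)"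
      using small_deviation[of p] by (simp add: add.commute)
  next
    fix p :: real assume sub: "subordinator M Z" and p: "1 < p"
    have mono: "AE \<omega> in M. \<forall>s t. 0 \<le> s \<longrightarrow> s \<le> t \<longrightarrow> 1 * Z s \<omega> \<le> 1 * Z t \<omega>"
      using sub by (simp add: subordinator_def)
    have "c\<^sub>m = 0" by (rule no_negative_jumps) (use AE_sign[OF mono] in simp)
    then show "((\<lambda>\<epsilon>. \<epsilon> powr (\<alpha> / (1 - \<alpha>)) *
          ln (measure M {\<omega> \<in> space M. strong_pvar p (\<lambda>t. Z t \<omega>) \<le> ennreal \<epsilon>}))
        \<longlongrightarrow> - (1 / \<alpha> - 1) * (c\<^sub>p * Gamma (1 - \<alpha>)) powr (1 / (1 - \<alpha>))) (at_right 0)"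
      \<comment> \<open>As \<open>c\<^sub>m\<close> vanishes, the sum of the coefficients in this
        limit is \<open>c\<^sub>p\<close>.\<close>
      using small_deviation_monotone[OF p mono] by simp
  next
    fix p :: real assume sub: "subordinator M (\<lambda>t \<omega>. - Z t \<omega>)" and p: "1 < p"
    have mono: "AE \<omega> in M. \<forall>s t. 0 \<le> s \<longrightarrow> s \<le> t \<longrightarrow> - 1 * Z s \<omega> \<le> - 1 * Z t \<omega>"
      using sub by (simp add: subordinator_def)
    have "c\<^sub>p = 0" by (rule no_positive_jumps) (use AE_sign[OF mono] in simp)
    then show "((\<lambda>\<epsilon>. \<epsilon> powr (\<alpha> / (1 - \<alpha>)) *
          ln (measure M {\<omega> \<in> space M. strong_pvar p (\<lambda>t. Z t \<omega>) \<le> ennreal \<epsilon>}))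
        \<longlongrightarrow> - (1 / \<alpha> - 1) * (c\<^sub>m * Gamma (1 - \<alpha>)) powr (1 / (1 - \<alpha>))) (at_right 0)"
      using small_deviation_monotone[OF p mono] by simp
  qed
qed

end
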